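(* If $\Lambda$ is a cyclicity prefix for a rule set $\mathcal{R}$, a head-choice $hc$, and some $\rho\in\mathcal{R}$, then $\Lambda^\infty$ is a cyclicity sequence for the KB $(\mathcal{R},D_\rho)$ and $hc$, and hence $\mathcal{R}$ never-terminates.
   Context: Setting (restricted disjunctive chase). Rules $\rho$: $\forall \vec w,\vec x.[\beta\to \bigvee_{i=1}^n \exists \vec y_i.\eta_i]$ with frontier $\vec x$, $\mathrm{branching}(\rho)=n$; datalog = $n=1$ without existential variables; skolemization $\mathrm{sk}(\rho)$ replaces $y\in\vec y_i$ by $f^\rho_{i,y}(\vec x)$. Trigger $\lambda=(\rho,\sigma)$: loaded for $F$ if $\mathrm{body}(\rho)\sigma\subseteq F$; obsolete for $F$ if some extension $\sigma'$ of $\sigma$ gives $\mathrm{head}_i(\rho)\sigma'\subseteq F$ for some $i$; $\mathrm{out}_i(\lambda)=\mathrm{head}_i(\mathrm{sk}(\rho))\sigma$; $\mathcal{R}$-triggers use rules of $\mathcal{R}$ and substitutions into terms over $\mathrm{sk}(\mathcal{R})$. Chase trees of $(\mathcal{R},D)$ are rooted at $D$, apply loaded non-obsolete $\mathcal{R}$-triggers (datalog first) with one child per disjunct labelled by adding $\mathrm{out}_i(\lambda)$, leaves satisfy all rules, and are fair; $\mathcal{R}$ never-terminates if some KB with $\mathcal{R}$ has no finite chase tree. A head-choice $hc$ picks a disjunct per rule; $\mathrm{out}_{hc}(\lambda)=\mathrm{out}_{hc(\rho)}(\lambda)$; $\mathrm{branch}(T,hc)$ is the branch of $T$ following $hc$.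 $\lambda$ is g-unblockable for KB $K$ and $hc$ if whenever it is loaded for a vertex label on $\mathrm{branch}(T,hc)$ of a chase tree $T$ of $K$, $\mathrm{out}_{hc}(\lambda)$ is in the label of some vertex of that branch. For a sequence $\Lambda=\lambda_1,\lambda_2,\dots$: $F_0=D$, $F_{i+1}=F_i\cup\mathrm{out}_{hc}(\lambda_{i+1})$; loaded if each $\lambda_{i+1}$ is loaded for $F_i$; growing if for each $i$ some $F_j$, $j>i$, has a term not in $F_i$; a cyclicity sequence is loaded, growing, and consists of g-unblockable triggers. Birth facts: $\mathrm{birth}(c)=\emptyset$ for constants; $\mathrm{birth}(f^\psi_{i,v}(\vec s))=\mathrm{out}_i((\psi,\tau))\cup\bigcup_{s}\mathrm{birth}(s)$ where $\tau$ maps $\mathrm{frontier}(\psi)$ to $\vec s$; $\mathrm{birth}((\psi,\tau))=\bigcup_{x\in\mathrm{frontier}(\psi)}\mathrm{birth}(\tau(x))$; $\mathrm{skel}(\lambda)$ = the terms of $\mathrm{birth}(\lambda)$ plus constants assigned to frontier variables. $h^{uc}_\lambda$ maps functional terms $f(\vec t)\notin\mathrm{skel}(\lambda)$ to fresh constants $c_f$, terms of $\mathrm{skel}(\lambda)$ and the $c_f$ to themselves, others to a special constant $\star$. $\mathcal{O}(\mathcal{R},hc,\lambda,h)$ is the minimal fact set containing all facts over predicates of $\mathcal{R}$ and constants in $\mathrm{skel}(\lambda)\cup\{\star\}$, including $\mathrm{birth}(\lambda)$, and including $h(\mathrm{out}_{hc}(\lambda'))$ for every $\mathcal{R}$-trigger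 $\lambda'$ loaded for it with $\mathrm{out}_{hc}(\lambda')\neq\mathrm{out}_{hc}(\lambda)$. $\lambda$ is uc-unblockable for $\mathcal{R}$ and $hc$ if its rule is datalog or it is not obsolete for $\mathcal{O}(\mathcal{R},hc,\lambda,h^{uc}_\lambda)$. A constant mapping $g$ (partial function from constants to terms) is reversible for a subterm-closed set $\mathcal{T}$ if it is defined on all constants of $\mathcal{T}$, injective on $\mathcal{T}$, and no functional $u\in\mathcal{T}$ has $g(u)$ equal to a subterm of $g(c)$ for a constant $c\in\mathcal{T}$. The rule-database of $\rho$ is $D_\rho=\mathrm{body}(\rho)\sigma_{uc}$, where $\sigma_{uc}$ maps each variable $x$ to a fresh constant $c_x$. A term is $\rho$-cyclic if it has the form $f(\vec s)$ with $f$ a function symbol of $\mathrm{sk}(\rho)$ also occurring in $\vec s$. A cyclicity prefix for $\mathcal{R}$, $hc$, $\rho$ is a finite list of $\mathcal{R}$-triggers $\Lambda=(\rho_0,\sigma_0),\dots,(\rho_n,\sigma_n)$ with: $\rho_0=\rho$, $\sigma_0=\sigma_{uc}$; $\Lambda$ loaded for $(\mathcal{R},D_\rho)$ and $hc$; each $(\rho_i,\sigma_i)$, $1\le i\le n$, uc-unblockable for $\mathcal{R}$ and $hc$, and $(\rho_0,\sigma_0)$ g-unblockable; $\rho_n=\rho$ and $\mathrm{out}_{hc}((\rho_n,\sigma_n))$ contains a $\rho$-cyclic term; the constant mapping $g_\Lambda$ with $g_\Lambda\circ\sigma_0=\sigma_n$ is reversible for $\mathrm{skel}((\rho_i,g_\Lambda^j\circ\sigma_i))$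 for all $1\le i\le n$, $j\ge 0$ ($g^0_\Lambda$ the identity). $\Lambda^\infty$ is the infinite sequence $(\rho_0,\sigma_0),(\rho_1,\sigma_1^1),\dots,(\rho_n,\sigma_n^1),(\rho_1,\sigma_1^2),\dots,(\rho_n,\sigma_n^2),\dots$ with $\sigma_i^j=g_\Lambda^{j-1}\circ\sigma_i$. *)

theory Defs
  imports Main
begin

section \<open>Rules and terms\<close>

type_synonym var = nat
type_synonym pred = nat

datatype 'a atom = Atom (pred_of: pred) (args: "'a list")

text \<open>Predicate names carry no fixed arity; the predicate of an atom is the pair of its name and
  its number of arguments.\<close>

definition atom_pred :: "'a atom \<Rightarrow> pred \<times> nat" where
  "atom_pred A = (pred_of A, length (args A))"

text \<open>A rule is given by its body and its list of head disjuncts. Variables that occur in the body are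
  universally quantified; a variable of a disjunct that does not occur in the body is existentially
  quantified in that disjunct. Disjuncts are indexed from 0.\<close>

datatype rule = Rule (body: "var atom list") (heads: "var atom list list")

definition rule_set :: "rule set \<Rightarrow> bool" where
  "rule_set R \<longleftrightarrow> (\<forall>\<rho>\<in>R. heads \<rho> \<noteq> [])"

definition branching :: "rule \<Rightarrow> nat" where
  "branching \<rho> = length (heads \<rho>)"

definition uvars :: "rule \<Rightarrow> var set" where
  "uvars \<rho> = (\<Union>A\<in>set (body \<rho>). set_atom A)"

definition exvars :: "rule \<Rightarrow> nat \<Rightarrow> var set" where
  "exvars \<rho> i = (\<Union>A\<in>set (heads \<rho> ! i). set_atom A) - uvars \<rho>"

text \<open>The frontier is a list (without repetitions), since it is the argument list of the Skolem terms.\<close>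

definition frontier :: "rule \<Rightarrow> var list" where
  "frontier \<rho> =
     filter (\<lambda>x. \<exists>\<eta>\<in>set (heads \<rho>). \<exists>A\<in>set \<eta>. x \<in> set_atom A)
       (remdups (concat (map args (body \<rho>))))"

definition datalog :: "rule \<Rightarrow> bool" where
  "datalog \<rho> \<longleftrightarrow> branching \<rho> = 1 \<and> exvars \<rho> 0 = {}"

definition preds :: "rule set \<Rightarrow> (pred \<times> nat) set" where
  "preds R = (\<Union>\<rho>\<in>R. atom_pred ` (set (body \<rho>) \<union> (\<Union>\<eta>\<in>set (heads \<rho>). set \<eta>)))"

text \<open>\<open>Sk \<rho> i y\<close> is the Skolem function symbol for the existential variable \<open>y\<close> of disjunct \<open>i\<close> of \<open>\<rho>\<close>;
  its arity is the length of the frontier of \<open>\<rho>\<close>.\<close>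

datatype skfun = Sk (sk_rule: rule) (sk_disj: nat) (sk_var: var)

definition sk_funs :: "rule \<Rightarrow> skfun set" where
  "sk_funs \<rho> = {Sk \<rho> i y | i y. i < branching \<rho> \<and> y \<in> exvars \<rho> i}"

text \<open>The leaves of a term are variables (in skolemized rules) or constants (in facts).\<close>

datatype 'a trm = Base 'a | Func skfun "'a trm list"

fun subst :: "('a \<Rightarrow> 'b trm) \<Rightarrow> 'a trm \<Rightarrow> 'b trm" where
  "subst \<sigma> (Base a) = \<sigma> a"
| "subst \<sigma> (Func f ts) = Func f (map (subst \<sigma>) ts)"

fun subterms :: "'a trm \<Rightarrow> 'a trm set" where
  "subterms (Base a) = {Base a}"
| "subterms (Func f ts) = insert (Func f ts) (\<Union>t\<in>set ts. subterms t)"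

fun funs :: "'a trm \<Rightarrow> skfun set" where
  "funs (Base a) = {}"
| "funs (Func f ts) = insert f (\<Union>t\<in>set ts. funs t)"

text \<open>Besides the ordinary constants \<open>Name k\<close> there are reserved ones: \<open>CVar x\<close> is the constant
  \<open>c\<^sub>x\<close> of rule-databases, \<open>CFun f\<close> is the constant \<open>c\<^sub>f\<close> that stands for the functional terms with
  outermost symbol \<open>f\<close>, and \<open>Star\<close> is the special constant. The constants \<open>CFun f\<close> and \<open>Star\<close> are
  thus fresh for every trigger whose terms are built from the constants of a rule-database.\<close>

datatype const = Name nat | CVar var | CFun skfun | Star

type_synonym gterm = "const trm"
type_synonym fact = "gterm atom"
type_synonym kb = "rule set \<times> fact set"

definition database :: "fact set \<Rightarrow> bool" where
  "database D \<longleftrightarrow> finite D \<and> (\<forall>A\<in>D. \<forall>t\<in>set_atom A. \<exists>c. t = Base c)"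

text \<open>The terms of a fact set are those that occur in it at any nesting depth; in particular, this
  set is closed under subterms.\<close>

definition terms :: "fact set \<Rightarrow> gterm set" where
  "terms F = (\<Union>A\<in>F. \<Union>t\<in>set_atom A. subterms t)"

section \<open>Triggers\<close>

text \<open>Substitutions are total functions, of which only the values on \<open>uvars \<rho>\<close> matter.\<close>

type_synonym trigger = "rule \<times> (var \<Rightarrow> gterm)"

definition body_inst :: "trigger \<Rightarrow> fact set" where
  "body_inst = (\<lambda>(\<rho>, \<sigma>). map_atom \<sigma> ` set (body \<rho>))"

definition sk_leaf :: "rule \<Rightarrow> nat \<Rightarrow> var \<Rightarrow> var trm" where
  "sk_leaf \<rho> i x =
     (if x \<in> uvars \<rho> then Base x else Func (Sk \<rho> i x) (map Base (frontier \<rho>)))"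

definition sk_head :: "rule \<Rightarrow> nat \<Rightarrow> var trm atom list" where
  "sk_head \<rho> i = map (map_atom (sk_leaf \<rho> i)) (heads \<rho> ! i)"

definition out :: "nat \<Rightarrow> trigger \<Rightarrow> fact set" where
  "out i = (\<lambda>(\<rho>, \<sigma>). map_atom (subst \<sigma>) ` set (sk_head \<rho> i))"

definition loaded :: "trigger \<Rightarrow> fact set \<Rightarrow> bool" where
  "loaded \<tau> F \<longleftrightarrow> body_inst \<tau> \<subseteq> F"

definition obsolete :: "trigger \<Rightarrow> fact set \<Rightarrow> bool" where
  "obsolete = (\<lambda>(\<rho>, \<sigma>) F. \<exists>\<sigma>'. (\<forall>x\<in>uvars \<rho>. \<sigma>' x = \<sigma> x) \<and>
     (\<exists>i<branching \<rho>. map_atom \<sigma>' ` set (heads \<rho> ! i) \<subseteq> F))"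

fun R_term :: "rule set \<Rightarrow> gterm \<Rightarrow> bool" where
  "R_term R (Base c) \<longleftrightarrow> True"
| "R_term R (Func f ts) \<longleftrightarrow> f \<in> (\<Union>\<rho>\<in>R. sk_funs \<rho>) \<and>
     length ts = length (frontier (sk_rule f)) \<and> (\<forall>t\<in>set ts. R_term R t)"

definition R_trigger :: "rule set \<Rightarrow> trigger \<Rightarrow> bool" where
  "R_trigger R = (\<lambda>(\<rho>, \<sigma>). \<rho> \<in> R \<and> (\<forall>x\<in>uvars \<rho>. R_term R (\<sigma> x)))"

definition satisfies :: "fact set \<Rightarrow> rule \<Rightarrow> bool" where
  "satisfies F \<rho> \<longleftrightarrow> (\<forall>\<sigma>. loaded (\<rho>, \<sigma>) F \<longrightarrow> obsolete (\<rho>, \<sigma>) F)"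

section \<open>Chase trees\<close>

text \<open>Vertices are addresses: the root is \<open>[]\<close>, and \<open>v @ [i]\<close> is the child of \<open>v\<close> for disjunct \<open>i\<close> of
  the rule of the trigger \<open>trg T v\<close> applied at \<open>v\<close>. The value of \<open>trg\<close> at leaves is irrelevant.\<close>

record ctree =
  verts :: "nat list set"
  lbl :: "nat list \<Rightarrow> fact set"
  trg :: "nat list \<Rightarrow> trigger"

definition leaf_ok :: "rule set \<Rightarrow> ctree \<Rightarrow> nat list \<Rightarrow> bool" where
  "leaf_ok R T v \<longleftrightarrow> (\<forall>i. v @ [i] \<notin> verts T) \<and> (\<forall>\<rho>\<in>R. satisfies (lbl T v) \<rho>)"

text \<open>The disjunction is the datalog-first condition.\<close>

definition step_ok :: "rule set \<Rightarrow> ctree \<Rightarrow> nat list \<Rightarrow> bool" where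
  "step_ok R T v \<longleftrightarrow>
     R_trigger R (trg T v) \<and>
     loaded (trg T v) (lbl T v) \<and> \<not> obsolete (trg T v) (lbl T v) \<and>
     (datalog (fst (trg T v)) \<or>
       (\<forall>\<tau>. R_trigger R \<tau> \<and> datalog (fst \<tau>) \<and> loaded \<tau> (lbl T v) \<longrightarrow> obsolete \<tau> (lbl T v))) \<and>
     (\<forall>i. v @ [i] \<in> verts T \<longleftrightarrow> i < branching (fst (trg T v))) \<and>
     (\<forall>i<branching (fst (trg T v)). lbl T (v @ [i]) = lbl T v \<union> out i (trg T v))"

definition fair :: "rule set \<Rightarrow> ctree \<Rightarrow> bool" where
  "fair R T \<longleftrightarrow> (\<forall>v\<in>verts T. \<forall>\<tau>. R_trigger R \<tau> \<and> loaded \<tau> (lbl T v) \<longrightarrow>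
     (\<exists>k. \<forall>w. length w = k \<and> v @ w \<in> verts T \<longrightarrow> obsolete \<tau> (lbl T (v @ w))))"

definition chase_tree :: "kb \<Rightarrow> ctree \<Rightarrow> bool" where
  "chase_tree = (\<lambda>(R, D) T.
     [] \<in> verts T \<and> lbl T [] = D \<and>
     (\<forall>v i. v @ [i] \<in> verts T \<longrightarrow> v \<in> verts T) \<and>
     (\<forall>v\<in>verts T. leaf_ok R T v \<or> step_ok R T v) \<and>
     fair R T)"

definition never_terminates :: "rule set \<Rightarrow> bool" where
  "never_terminates R \<longleftrightarrow>
     (\<exists>D. database D \<and> \<not> (\<exists>T. chase_tree (R, D) T \<and> finite (verts T)))"

section \<open>Head-choices and cyclicity sequences\<close>

type_synonym head_choice = "rule \<Rightarrow> nat"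

definition is_head_choice :: "rule set \<Rightarrow> head_choice \<Rightarrow> bool" where
  "is_head_choice R hc \<longleftrightarrow> (\<forall>\<rho>\<in>R. hc \<rho> < branching \<rho>)"

definition out_hc :: "head_choice \<Rightarrow> trigger \<Rightarrow> fact set" where
  "out_hc hc \<tau> = out (hc (fst \<tau>)) \<tau>"

inductive_set branch :: "ctree \<Rightarrow> head_choice \<Rightarrow> nat list set"
  for T :: ctree and hc :: head_choice where
  root: "[] \<in> branch T hc"
| child: "v \<in> branch T hc \<Longrightarrow> v @ [hc (fst (trg T v))] \<in> verts T
    \<Longrightarrow> v @ [hc (fst (trg T v))] \<in> branch T hc"

definition g_unblockable :: "kb \<Rightarrow> head_choice \<Rightarrow> trigger \<Rightarrow> bool" where
  "g_unblockable K hc \<tau> \<longleftrightarrow> (\<forall>T. chase_tree K T \<longrightarrow>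
     (\<forall>v\<in>branch T hc. loaded \<tau> (lbl T v) \<longrightarrow> (\<exists>u\<in>branch T hc. out_hc hc \<tau> \<subseteq> lbl T u)))"

text \<open>Sequences are indexed from 0, so \<open>facts_after D hc s k\<close> adds to \<open>D\<close> the outputs of the first \<open>k\<close>
  triggers \<open>s 0, \<dots>, s (k - 1)\<close>.\<close>

primrec facts_after :: "fact set \<Rightarrow> head_choice \<Rightarrow> (nat \<Rightarrow> trigger) \<Rightarrow> nat \<Rightarrow> fact set" where
  "facts_after D hc s 0 = D"
| "facts_after D hc s (Suc k) = facts_after D hc s k \<union> out_hc hc (s k)"

definition loaded_seq :: "kb \<Rightarrow> head_choice \<Rightarrow> (nat \<Rightarrow> trigger) \<Rightarrow> bool" where
  "loaded_seq K hc s \<longleftrightarrow> (\<forall>k. loaded (s k) (facts_after (snd K) hc s k))"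

definition loaded_list :: "kb \<Rightarrow> head_choice \<Rightarrow> trigger list \<Rightarrow> bool" where
  "loaded_list K hc \<Lambda> \<longleftrightarrow>
     (\<forall>k<length \<Lambda>. loaded (\<Lambda> ! k) (facts_after (snd K) hc (nth \<Lambda>) k))"

definition growing_seq :: "kb \<Rightarrow> head_choice \<Rightarrow> (nat \<Rightarrow> trigger) \<Rightarrow> bool" where
  "growing_seq K hc s \<longleftrightarrow> (\<forall>i. \<exists>j>i. \<exists>t.
     t \<in> terms (facts_after (snd K) hc s j) \<and> t \<notin> terms (facts_after (snd K) hc s i))"

definition cyclicity_sequence :: "kb \<Rightarrow> head_choice \<Rightarrow> (nat \<Rightarrow> trigger) \<Rightarrow> bool" where
  "cyclicity_sequence K hc s \<longleftrightarrow>
     (\<forall>k. R_trigger (fst K) (s k)) \<and> loaded_seq K hc s \<and> growing_seq K hc s \<and>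
     (\<forall>k. g_unblockable K hc (s k))"

section \<open>Unblockability\<close>

definition frontier_subst :: "rule \<Rightarrow> gterm list \<Rightarrow> var \<Rightarrow> gterm" where
  "frontier_subst \<psi> ts x = the (map_of (zip (frontier \<psi>) ts) x)"

fun birth :: "gterm \<Rightarrow> fact set" where
  "birth (Base c) = {}"
| "birth (Func (Sk \<psi> i y) ts) = out i (\<psi>, frontier_subst \<psi> ts) \<union> (\<Union>t\<in>set ts. birth t)"

definition birth_trg :: "trigger \<Rightarrow> fact set" where
  "birth_trg = (\<lambda>(\<rho>, \<sigma>). \<Union>x\<in>set (frontier \<rho>). birth (\<sigma> x))"

definition skel :: "trigger \<Rightarrow> gterm set" where
  "skel = (\<lambda>(\<rho>, \<sigma>). terms (birth_trg (\<rho>, \<sigma>)) \<union>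
     {Base c | c. \<exists>x\<in>set (frontier \<rho>). \<sigma> x = Base c})"

definition h_uc :: "trigger \<Rightarrow> gterm \<Rightarrow> gterm" where
  "h_uc \<tau> t = (if t \<in> skel \<tau> then t else
     case t of Func f ts \<Rightarrow> Base (CFun f) | Base (CFun f) \<Rightarrow> Base (CFun f) | Base _ \<Rightarrow> Base Star)"

definition const_facts :: "rule set \<Rightarrow> const set \<Rightarrow> fact set" where
  "const_facts R C = {Atom p (map Base cs) | p cs. (p, length cs) \<in> preds R \<and> set cs \<subseteq> C}"

text \<open>The conditions on \<open>F\<close> are preserved under arbitrary intersections, so this is the least fact set
  that satisfies them. The mapping \<open>h\<close> is applied to the arguments of facts and not recursively
  inside of functional terms.\<close>

definition overapprox :: "rule set \<Rightarrow> head_choice \<Rightarrow> trigger \<Rightarrow> (gterm \<Rightarrow> gterm) \<Rightarrow> fact set" where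
  "overapprox R hc \<tau> h = \<Inter> {F.
     const_facts R ({c. Base c \<in> skel \<tau>} \<union> {Star}) \<subseteq> F \<and>
     birth_trg \<tau> \<subseteq> F \<and>
     (\<forall>\<tau>'. R_trigger R \<tau>' \<and> loaded \<tau>' F \<and> out_hc hc \<tau>' \<noteq> out_hc hc \<tau> \<longrightarrow>
        map_atom h ` out_hc hc \<tau>' \<subseteq> F)}"

definition uc_unblockable :: "rule set \<Rightarrow> head_choice \<Rightarrow> trigger \<Rightarrow> bool" where
  "uc_unblockable R hc \<tau> \<longleftrightarrow>
     datalog (fst \<tau>) \<or> \<not> obsolete \<tau> (overapprox R hc \<tau> (h_uc \<tau>))"

section \<open>Cyclicity prefixes\<close>

type_synonym const_map = "const \<rightharpoonup> gterm"

text \<open>Constants on which the partial map is undefined are left unchanged.\<close>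

definition apply_map :: "const_map \<Rightarrow> gterm \<Rightarrow> gterm" where
  "apply_map g = subst (\<lambda>c. case g c of None \<Rightarrow> Base c | Some t \<Rightarrow> t)"

definition reversible :: "const_map \<Rightarrow> gterm set \<Rightarrow> bool" where
  "reversible g \<T> \<longleftrightarrow>
     (\<forall>c. Base c \<in> \<T> \<longrightarrow> c \<in> dom g) \<and>
     inj_on (apply_map g) \<T> \<and>
     \<not> (\<exists>f ts c. Func f ts \<in> \<T> \<and> Base c \<in> \<T> \<and>
          apply_map g (Func f ts) \<in> subterms (apply_map g (Base c)))"

definition \<sigma>_uc :: "var \<Rightarrow> gterm" where
  "\<sigma>_uc x = Base (CVar x)"

definition rule_database :: "rule \<Rightarrow> fact set" where
  "rule_database \<rho> = body_inst (\<rho>, \<sigma>_uc)"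

definition rule_cyclic :: "rule \<Rightarrow> gterm \<Rightarrow> bool" where
  "rule_cyclic \<rho> t \<longleftrightarrow> (\<exists>f ts. t = Func f ts \<and> f \<in> sk_funs \<rho> \<and> (\<exists>s\<in>set ts. f \<in> funs s))"

text \<open>The partial map \<open>g\<close> with \<open>g \<circ> \<sigma>\<^sub>0 = \<sigma>\<^sub>n\<close>, where \<open>\<sigma>\<^sub>0\<close> and \<open>\<sigma>\<^sub>n\<close> are the substitutions of the first
  and the last trigger, with \<open>\<sigma>\<^sub>0 = \<sigma>_uc\<close>, both regarded as functions on the body variables of the
  rule.\<close>

definition prefix_map :: "trigger list \<Rightarrow> const_map" where
  "prefix_map \<Lambda> c = (case c of
     CVar x \<Rightarrow> if x \<in> uvars (fst (hd \<Lambda>)) then Some (snd (last \<Lambda>) x) else None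
   | _ \<Rightarrow> None)"

definition shift_trigger :: "const_map \<Rightarrow> nat \<Rightarrow> trigger \<Rightarrow> trigger" where
  "shift_trigger g j = (\<lambda>(\<rho>, \<sigma>). (\<rho>, (apply_map g ^^ j) \<circ> \<sigma>))"

definition cyclicity_prefix ::
    "rule set \<Rightarrow> head_choice \<Rightarrow> rule \<Rightarrow> trigger list \<Rightarrow> bool" where
  "cyclicity_prefix R hc \<rho> \<Lambda> \<longleftrightarrow>
     \<Lambda> \<noteq> [] \<and>
     (\<forall>\<tau>\<in>set \<Lambda>. R_trigger R \<tau>) \<and>
     hd \<Lambda> = (\<rho>, \<sigma>_uc) \<and>
     loaded_list (R, rule_database \<rho>) hc \<Lambda> \<and>
     (\<forall>\<tau>\<in>set (tl \<Lambda>). uc_unblockable R hc \<tau>) \<and>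
     g_unblockable (R, rule_database \<rho>) hc (hd \<Lambda>) \<and>
     fst (last \<Lambda>) = \<rho> \<and>
     (\<exists>t\<in>terms (out_hc hc (last \<Lambda>)). rule_cyclic \<rho> t) \<and>
     (\<forall>\<tau>\<in>set (tl \<Lambda>). \<forall>j. reversible (prefix_map \<Lambda>) (skel (shift_trigger (prefix_map \<Lambda>) j \<tau>)))"

text \<open>The infinite unfolding: after the first trigger, round \<open>j = 0, 1, \<dots>\<close> consists of the remaining
  triggers shifted \<open>j\<close> times. In a cyclicity prefix \<open>tl \<Lambda>\<close> is not empty, because the output of the
  first trigger contains no cyclic term.\<close>

definition prefix_unfold :: "trigger list \<Rightarrow> nat \<Rightarrow> trigger" where
  "prefix_unfold \<Lambda> k = (case k of
     0 \<Rightarrow> hd \<Lambda>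
   | Suc m \<Rightarrow> shift_trigger (prefix_map \<Lambda>) (m div length (tl \<Lambda>)) (tl \<Lambda> ! (m mod length (tl \<Lambda>))))"

end

theory Submission imports Defs begin

text \<open>Write \<open>g\<close> for the map of the prefix, so that round \<open>j\<close> of the unfolding is shifted by \<open>g\<^sup>j\<close>.

  Loadedness: \<open>g\<close> sends the database to the body instance of the last trigger and the output of the first
  trigger to that of the last, hence sends the facts before step \<open>k\<close> into those before step \<open>k + n\<close>.

  Growth: a non-datalog uc-unblockable trigger has a functional term in its frontier, so every
  functional term of the prefix contains a Skolem term over the whole frontier of \<open>\<rho>\<close> with the original
  constants. One of these constants is thus mapped by \<open>g\<close> to a term that contains it properly.

  Unblockability: if the output of \<open>\<lambda>\<close> never appears on a branch, \<open>h\<^sup>u\<^sup>c\<close> maps the labels of the branch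
  into the overapproximation, so \<open>\<lambda>\<close> cannot become obsolete there, contrary to fairness. Reversibility
  provides a partial inverse of \<open>g\<close> that maps the overapproximation of \<open>g \<lambda>\<close> into that of \<open>\<lambda>\<close>; thus
  uc-unblockability is inherited by the shifted triggers.\<close>

section \<open>Outputs and terms\<close>

definition head_vars :: "rule \<Rightarrow> nat \<Rightarrow> var set" where
  "head_vars \<rho> i = (\<Union>A\<in>set (heads \<rho> ! i). set_atom A)"

text \<open>Skolemization and substitution fused into one map on variables, so that an output
  becomes the image of the original disjunct under a single function.\<close>

definition head_val :: "rule \<Rightarrow> nat \<Rightarrow> (var \<Rightarrow> gterm) \<Rightarrow> var \<Rightarrow> gterm" where
  "head_val \<rho> i \<sigma> x = (if x \<in> uvars \<rho> then \<sigma> x else Func (Sk \<rho> i x) (map \<sigma> (frontier \<rho>)))"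

lemma out_eq: "out i (\<rho>, \<sigma>) = map_atom (head_val \<rho> i \<sigma>) ` set (heads \<rho> ! i)"
proof -
  have "subst \<sigma> \<circ> sk_leaf \<rho> i = head_val \<rho> i \<sigma>"
    by (auto simp: fun_eq_iff sk_leaf_def head_val_def)
  then show ?thesis
    by (simp add: out_def sk_head_def image_image atom.map_comp)
qed

lemma set_atom_args: "set_atom A = set (args A)"
  by (cases A) simp

lemma args_out: "(\<Union>A\<in>out i (\<rho>, \<sigma>). set_atom A) = head_val \<rho> i \<sigma> ` head_vars \<rho> i"
  by (auto simp: out_eq head_vars_def atom.set_map)

lemma frontier_iff:
  "x \<in> set (frontier \<rho>) \<longleftrightarrow> x \<in> uvars \<rho> \<and> (\<exists>i<branching \<rho>. x \<in> head_vars \<rho> i)"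
  by (auto simp: frontier_def uvars_def head_vars_def branching_def set_atom_args in_set_conv_nth)
    (metis nth_mem)+

lemma frontier_uvars: "x \<in> set (frontier \<rho>) \<Longrightarrow> x \<in> uvars \<rho>"
  by (simp add: frontier_iff)

lemma distinct_frontier: "distinct (frontier \<rho>)"
  by (simp add: frontier_def)

lemma exvars_iff: "x \<in> exvars \<rho> i \<longleftrightarrow> x \<in> head_vars \<rho> i \<and> x \<notin> uvars \<rho>"
  by (auto simp: exvars_def head_vars_def)

lemma head_vars_cases:
  assumes "i < branching \<rho>" "x \<in> head_vars \<rho> i"
  obtains "x \<in> set (frontier \<rho>)" "x \<in> uvars \<rho>" "head_val \<rho> i \<sigma> x = \<sigma> x"
  | "x \<in> exvars \<rho> i" "x \<notin> uvars \<rho>" "head_val \<rho> i \<sigma> x = Func (Sk \<rho> i x) (map \<sigma> (frontier \<rho>))"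
  using assms by (cases "x \<in> uvars \<rho>") (auto simp: frontier_iff exvars_iff head_val_def)

lemma head_varsI: "A \<in> set (heads \<rho> ! i) \<Longrightarrow> x \<in> set_atom A \<Longrightarrow> x \<in> head_vars \<rho> i"
  by (auto simp: head_vars_def)

text \<open>Meant for maps such as \<open>h_uc\<close> that act on whole arguments and need not
  commute with function symbols: two substitutions may differ and their outputs still have the same
  image.\<close>

lemma map_out_cong:
  assumes "\<And>x. x \<in> head_vars \<rho> i \<Longrightarrow> f (head_val \<rho> i \<sigma> x) = f' (head_val \<rho> i \<sigma>' x)"
  shows "map_atom f ` out i (\<rho>, \<sigma>) = map_atom f' ` out i (\<rho>, \<sigma>')"
  unfolding out_eq image_image
  by (intro image_cong refl) (simp add: atom.map_comp head_varsI assms cong: atom.map_cong)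

lemma out_cong_head_val:
  assumes "\<And>x. x \<in> head_vars \<rho> i \<Longrightarrow> head_val \<rho> i \<sigma> x = head_val \<rho> i \<sigma>' x"
  shows "out i (\<rho>, \<sigma>) = out i (\<rho>, \<sigma>')"
  using assms unfolding out_eq
  by (intro image_cong) (auto simp: head_vars_def intro!: atom.map_cong)

lemma out_cong:
  assumes "i < branching \<rho>" "\<And>x. x \<in> set (frontier \<rho>) \<Longrightarrow> \<sigma> x = \<sigma>' x"
  shows "out i (\<rho>, \<sigma>) = out i (\<rho>, \<sigma>')"
proof (rule out_cong_head_val)
  fix x assume "x \<in> head_vars \<rho> i"
  then show "head_val \<rho> i \<sigma> x = head_val \<rho> i \<sigma>' x"
    using assms by (auto simp: head_val_def frontier_iff)
qed

lemma apply_map_Func [simp]: "apply_map g (Func f ts) = Func f (map (apply_map g) ts)"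
  by (simp add: apply_map_def)

text \<open>A constant mapping acts inside functional terms and hence commutes with the Skolem
  symbols, unlike \<open>h_uc\<close>.\<close>

lemma map_out_apply_map: "map_atom (apply_map g) ` out i (\<rho>, \<sigma>) = out i (\<rho>, apply_map g \<circ> \<sigma>)"
proof -
  have "apply_map g \<circ> head_val \<rho> i \<sigma> = head_val \<rho> i (apply_map g \<circ> \<sigma>)"
    by (auto simp: fun_eq_iff head_val_def)
  then show ?thesis
    by (simp add: out_eq image_image atom.map_comp)
qed

lemma body_inst_comp: "body_inst (\<rho>, f \<circ> \<sigma>) = map_atom f ` body_inst (\<rho>, \<sigma>)"
  by (simp add: body_inst_def image_image atom.map_comp)

lemma body_inst_cong:
  "(\<And>x. x \<in> uvars \<rho> \<Longrightarrow> \<sigma> x = \<sigma>' x) \<Longrightarrow> body_inst (\<rho>, \<sigma>) = body_inst (\<rho>, \<sigma>')"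
  unfolding body_inst_def by (auto simp: uvars_def intro!: image_cong atom.map_cong)

lemma args_body_inst: "(\<Union>A\<in>body_inst (\<rho>, \<sigma>). set_atom A) = \<sigma> ` uvars \<rho>"
  by (auto simp: body_inst_def uvars_def atom.set_map)

lemma finite_out: "finite (out i \<tau>)"
  by (cases \<tau>) (simp add: out_eq)

section \<open>Subterms and the terms of fact sets\<close>

lemma subterms_refl [simp]: "t \<in> subterms t"
  by (cases t) auto

lemma subterms_trans: "t \<in> subterms u \<Longrightarrow> s \<in> subterms t \<Longrightarrow> s \<in> subterms u"
  by (induction u) auto

lemma finite_subterms: "finite (subterms t)"
  by (induction t) auto

lemma subterms_size: "s \<in> subterms t \<Longrightarrow> size s \<le> size (t :: 'a trm)"
proof (induction t)
  case (Func f ts)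
  then show ?case
    using size_list_estimation'[of _ ts "size s" size] by (fastforce intro: le_SucI)
qed simp

lemma subterms_apply_map: "s \<in> subterms t \<Longrightarrow> apply_map g s \<in> subterms (apply_map g t)"
  by (induction t) auto

lemma finite_terms: "finite F \<Longrightarrow> finite (terms F)"
  by (auto simp: terms_def finite_subterms set_atom_args)

lemma terms_mono: "F \<subseteq> G \<Longrightarrow> terms F \<subseteq> terms G"
  by (auto simp: terms_def)

lemma terms_Un: "terms (F \<union> G) = terms F \<union> terms G"
  by (auto simp: terms_def)

lemma terms_out: "terms (out i (\<rho>, \<sigma>)) = (\<Union>x\<in>head_vars \<rho> i. subterms (head_val \<rho> i \<sigma> x))"
proof -
  have "terms (out i (\<rho>, \<sigma>)) = (\<Union>t\<in>(\<Union>A\<in>out i (\<rho>, \<sigma>). set_atom A). subterms t)"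
    by (auto simp: terms_def)
  then show ?thesis by (simp add: args_out)
qed

text \<open>A proper subterm of a new Skolem term lies in the value of a frontier variable. Frontier
  variables are body variables, so it falls under the first case.\<close>

lemma terms_out_cases:
  assumes "t \<in> terms (out i (\<psi>, \<mu>))"
  obtains x where "x \<in> uvars \<psi>" "t \<in> subterms (\<mu> x)"
  | x where "x \<in> head_vars \<psi> i" "x \<notin> uvars \<psi>" "t = Func (Sk \<psi> i x) (map \<mu> (frontier \<psi>))"
proof -
  obtain x where x: "x \<in> head_vars \<psi> i" "t \<in> subterms (head_val \<psi> i \<mu> x)"
    using assms by (auto simp: terms_out)
  show thesis
  proof (cases "x \<in> uvars \<psi>")
    case True
    then show ?thesis using x that(1) by (simp add: head_val_def)
  next
    case False
    then have "t = Func (Sk \<psi> i x) (map \<mu> (frontier \<psi>)) \<or>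
        (\<exists>z\<in>set (frontier \<psi>). t \<in> subterms (\<mu> z))"
      using x by (auto simp: head_val_def)
    then show ?thesis using that x(1) False frontier_uvars by metis
  qed
qed

lemma terms_body_inst: "terms (body_inst (\<rho>, \<sigma>)) = (\<Union>x\<in>uvars \<rho>. subterms (\<sigma> x))"
proof -
  have "terms (body_inst (\<rho>, \<sigma>)) = (\<Union>t\<in>(\<Union>A\<in>body_inst (\<rho>, \<sigma>). set_atom A). subterms t)"
    by (auto simp: terms_def)
  then show ?thesis by (simp add: args_body_inst)
qed

lemma R_term_apply_map:
  assumes "\<And>c t. g c = Some t \<Longrightarrow> R_term R t"
  shows "R_term R t \<Longrightarrow> R_term R (apply_map g t)"
proof (induction t)
  case (Base c)
  then show ?case using assms by (cases "g c") (auto simp: apply_map_def)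
qed auto

section \<open>Skeletons\<close>

text \<open>The contribution of one frontier term to the skeleton, as a direct recursion. A Skolem
  term brings along its siblings, the Skolem terms of the same disjunct over the same arguments,
  because one output creates them together.\<close>

fun term_skel :: "gterm \<Rightarrow> gterm set" where
  "term_skel (Base c) = {Base c}"
| "term_skel (Func (Sk \<psi> i y) ts) =
     (\<lambda>y'. Func (Sk \<psi> i y') ts) ` exvars \<psi> i \<union> (\<Union>t\<in>set ts. term_skel t)"

lemma R_term_Sk:
  "R_term R (Func (Sk \<psi> i y) ts) \<longleftrightarrow> \<psi> \<in> R \<and> i < branching \<psi> \<and> y \<in> exvars \<psi> i \<and>
     length ts = length (frontier \<psi>) \<and> (\<forall>t\<in>set ts. R_term R t)"
  by (auto simp: sk_funs_def)

lemma frontier_subst_map: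
  "length ts = length (frontier \<psi>) \<Longrightarrow> map (frontier_subst \<psi> ts) (frontier \<psi>) = ts"
  by (rule nth_equalityI)
    (simp_all add: frontier_subst_def map_of_zip_nth[OF _ distinct_frontier])

lemma frontier_subst_in:
  "length ts = length (frontier \<psi>) \<Longrightarrow> x \<in> set (frontier \<psi>) \<Longrightarrow> frontier_subst \<psi> ts x \<in> set ts"
  using frontier_subst_map[of ts \<psi>] by (metis list.set_map imageI)

lemma head_val_frontier_subst:
  assumes "i < branching \<psi>" "length ts = length (frontier \<psi>)" "x \<in> head_vars \<psi> i"
  obtains "head_val \<psi> i (frontier_subst \<psi> ts) x \<in> set ts"
  | "x \<in> exvars \<psi> i" "head_val \<psi> i (frontier_subst \<psi> ts) x = Func (Sk \<psi> i x) ts"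
  using assms(1,3)
proof (cases rule: head_vars_cases[where \<sigma> = "frontier_subst \<psi> ts"])
  case 1
  then show thesis using that(1) frontier_subst_in[OF assms(2)] by simp
next
  case 2
  then show thesis using that(2) frontier_subst_map[OF assms(2)] by simp
qed

lemma term_skel_refl: "R_term R t \<Longrightarrow> t \<in> term_skel t"
proof (cases t)
  case (Func f ts)
  moreover assume "R_term R t"
  ultimately show ?thesis by (cases f) (auto simp del: R_term.simps simp: R_term_Sk)
qed simp

lemma term_skel_trans: "t \<in> term_skel u \<Longrightarrow> term_skel t \<subseteq> term_skel u"
  by (induction u rule: term_skel.induct) fastforce+

lemma term_skel_R_term: "t \<in> term_skel u \<Longrightarrow> R_term R u \<Longrightarrow> R_term R t"
  by (induction u rule: term_skel.induct) (auto simp del: R_term.simps(2) simp: R_term_Sk)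

lemma subterms_term_skel: "R_term R u \<Longrightarrow> t \<in> subterms u \<Longrightarrow> t \<in> term_skel u"
  by (induction u rule: term_skel.induct) (auto simp del: R_term.simps(2) simp: R_term_Sk)

text \<open>Elements of a skeleton need not be subterms, but each functional one has a sibling that
  is. This carries the third condition of reversibility from subterms over to skeletons.\<close>

lemma term_skel_sibling:
  "Func (Sk \<psi> i y) ts \<in> term_skel u \<Longrightarrow> R_term R u \<Longrightarrow>
     \<exists>y'\<in>exvars \<psi> i. Func (Sk \<psi> i y') ts \<in> subterms u"
  by (induction u rule: term_skel.induct) (fastforce simp del: R_term.simps(2) simp: R_term_Sk)+

lemma terms_UN: "terms (\<Union>x\<in>X. F x) = (\<Union>x\<in>X. terms (F x))"
  by (auto simp: terms_def)

text \<open>The output that creates \<open>Func (Sk \<psi> i y) ts\<close> has as its terms the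
  siblings and the subterms of \<open>ts\<close>; all of \<open>ts\<close> occurs because
  \<open>y\<close> is existential, so at least one Skolem term is present. Constants have no birth
  facts and are therefore added separately.\<close>

lemma terms_birth:
  "R_term R t \<Longrightarrow> terms (birth t) \<union> {Base c | c. t = Base c} = term_skel t"
proof (induction t rule: term_skel.induct)
  case (1 c)
  then show ?case by (auto simp: terms_def)
next
  case (2 \<psi> i y ts)
  have i: "i < branching \<psi>" and y: "y \<in> exvars \<psi> i"
    and len: "length ts = length (frontier \<psi>)" and Rts: "\<forall>t\<in>set ts. R_term R t"
    using 2(2) by (auto simp del: R_term.simps simp: R_term_Sk)
  let ?\<tau> = "frontier_subst \<psi> ts"
  have ex: "head_val \<psi> i ?\<tau> x = Func (Sk \<psi> i x) ts" if "x \<in> exvars \<psi> i" for x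
    using that frontier_subst_map[OF len] by (simp add: exvars_iff head_val_def)
  have o: "terms (out i (\<psi>, ?\<tau>)) =
      (\<lambda>y'. Func (Sk \<psi> i y') ts) ` exvars \<psi> i \<union> (\<Union>t\<in>set ts. subterms t)" (is "?L = ?A \<union> ?B")
  proof
    show "?L \<subseteq> ?A \<union> ?B"
    proof
      fix u assume "u \<in> ?L"
      then obtain x where x: "x \<in> head_vars \<psi> i" "u \<in> subterms (head_val \<psi> i ?\<tau> x)"
        by (auto simp: terms_out)
      show "u \<in> ?A \<union> ?B"
        by (rule head_val_frontier_subst[OF i len x(1)]) (use x in auto)
    qed
    have "subterms (head_val \<psi> i ?\<tau> x) \<subseteq> ?L" if "x \<in> exvars \<psi> i" for x
      using that by (auto simp: terms_out exvars_iff)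
    then have "insert (Func (Sk \<psi> i x) ts) ?B \<subseteq> ?L" if "x \<in> exvars \<psi> i" for x
      using that ex[OF that] by force
    then show "?A \<union> ?B \<subseteq> ?L" using y by blast
  qed
  have IH: "subterms t \<union> terms (birth t) = term_skel t" if t: "t \<in> set ts" for t
  proof -
    have "R_term R t" using Rts t by blast
    then have "subterms t \<subseteq> term_skel t" using subterms_term_skel by blast
    moreover have "{Base c | c. t = Base c} \<subseteq> subterms t" by auto
    ultimately show ?thesis using 2(1)[OF t \<open>R_term R t\<close>] by auto
  qed
  have "terms (birth (Func (Sk \<psi> i y) ts)) =
      ?A \<union> (\<Union>t\<in>set ts. subterms t \<union> terms (birth t))"
    by (simp add: o terms_Un terms_UN Un_assoc UN_Un_distrib)
  then show ?case using IH by simp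
qed

lemma skel_eq:
  assumes "R_trigger R (\<rho>, \<sigma>)"
  shows "skel (\<rho>, \<sigma>) = (\<Union>x\<in>set (frontier \<rho>). term_skel (\<sigma> x))"
proof -
  have "terms (birth (\<sigma> x)) \<union> {Base c | c. \<sigma> x = Base c} = term_skel (\<sigma> x)"
    if "x \<in> set (frontier \<rho>)" for x
    using assms that by (intro terms_birth) (auto simp: R_trigger_def frontier_uvars)
  moreover have "skel (\<rho>, \<sigma>) =
      (\<Union>x\<in>set (frontier \<rho>). terms (birth (\<sigma> x)) \<union> {Base c | c. \<sigma> x = Base c})"
    by (auto simp: skel_def birth_trg_def terms_def)
  ultimately show ?thesis by simp
qed

lemma skel_frontier:
  "R_trigger R (\<rho>, \<sigma>) \<Longrightarrow> x \<in> set (frontier \<rho>) \<Longrightarrow> \<sigma> x \<in> skel (\<rho>, \<sigma>)"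
  using term_skel_refl by (fastforce simp: skel_eq R_trigger_def frontier_uvars)

lemma skel_R_term: "R_trigger R (\<rho>, \<sigma>) \<Longrightarrow> t \<in> skel (\<rho>, \<sigma>) \<Longrightarrow> R_term R t"
  using term_skel_R_term by (fastforce simp: skel_eq R_trigger_def frontier_uvars)

lemma skel_closed: "R_trigger R (\<rho>, \<sigma>) \<Longrightarrow> t \<in> skel (\<rho>, \<sigma>) \<Longrightarrow> term_skel t \<subseteq> skel (\<rho>, \<sigma>)"
  using term_skel_trans by (fastforce simp: skel_eq)

lemma skel_args:
  assumes "R_trigger R (\<rho>, \<sigma>)" "Func f ts \<in> skel (\<rho>, \<sigma>)" "t \<in> set ts"
  shows "t \<in> skel (\<rho>, \<sigma>)"
proof -
  have "R_term R t" using skel_R_term[OF assms(1,2)] assms(3) by simp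
  then have "t \<in> term_skel (Func f ts)"
    using term_skel_refl assms(3) by (cases f) auto
  then show ?thesis using skel_closed[OF assms(1,2)] by blast
qed

lemma args_birth:
  assumes "R_term R t" "A \<in> birth t" "u \<in> set_atom A"
  shows "u \<in> term_skel t"
proof -
  have "u \<in> terms (birth t)"
    using assms(2,3) unfolding terms_def by (blast intro: subterms_refl)
  then show ?thesis using terms_birth[OF assms(1)] by blast
qed

lemma head_preds:
  assumes "\<rho> \<in> R" "i < branching \<rho>" "A \<in> set (heads \<rho> ! i)"
  shows "atom_pred A \<in> preds R"
proof -
  have "heads \<rho> ! i \<in> set (heads \<rho>)" using assms(2) by (simp add: branching_def)
  then show ?thesis using assms(1,3) unfolding preds_def by blast
qed

lemma birth_preds: "R_term R t \<Longrightarrow> A \<in> birth t \<Longrightarrow> atom_pred A \<in> preds R"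
proof (induction t rule: term_skel.induct)
  case (2 \<psi> i y ts)
  have R: "\<psi> \<in> R" "i < branching \<psi>" "\<forall>t\<in>set ts. R_term R t"
    using 2(2) by (auto simp del: R_term.simps simp: R_term_Sk)
  show ?case
  proof (cases "A \<in> out i (\<psi>, frontier_subst \<psi> ts)")
    case True
    then obtain B where "B \<in> set (heads \<psi> ! i)" "atom_pred A = atom_pred B"
      by (auto simp: out_eq atom_pred_def atom.map_sel)
    then show ?thesis using head_preds[OF R(1,2)] by simp
  next
    case False
    then show ?thesis using 2 R by auto
  qed
qed simp

text \<open>Siblings are born in the same output, so this covers also those elements of the skeleton
  that are not subterms.\<close>

lemma birth_out:
  "Func (Sk \<psi> i y) ts \<in> term_skel t \<Longrightarrow> out i (\<psi>, frontier_subst \<psi> ts) \<subseteq> birth t"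
  by (induction t rule: term_skel.induct) auto

section \<open>Skeletons and birth facts under constant mappings\<close>

lemma term_skel_apply_map_image:
  "u \<in> term_skel t \<Longrightarrow> R_term R (apply_map g u) \<Longrightarrow> apply_map g u \<in> term_skel (apply_map g t)"
  by (induction t rule: term_skel.induct) (auto intro: term_skel_refl)

text \<open>The recursion runs in parallel on \<open>t\<close> and on its image until it meets a
  constant of \<open>t\<close>; from there on it sees only the term put in for that constant. The
  analogous split for birth facts is \<open>birth_apply_map_cases\<close>.\<close>

lemma term_skel_apply_map_cases:
  "u \<in> term_skel (apply_map g t) \<Longrightarrow>
     (\<exists>f ts. Func f ts \<in> term_skel t \<and> u = apply_map g (Func f ts)) \<or>
     (\<exists>c. Base c \<in> term_skel t \<and> u \<in> term_skel (apply_map g (Base c)))"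
  by (induction t rule: term_skel.induct) fastforce+

text \<open>Outside the frontier \<open>frontier_subst\<close> has the unspecified value
  \<open>the None\<close>, so the two substitutions are compared only through their outputs.\<close>

lemma frontier_subst_apply_map:
  assumes "i < branching \<psi>" "length ts = length (frontier \<psi>)"
  shows "out i (\<psi>, frontier_subst \<psi> (map f ts)) = out i (\<psi>, f \<circ> frontier_subst \<psi> ts)"
proof (rule out_cong[OF assms(1)])
  have "map (frontier_subst \<psi> (map f ts)) (frontier \<psi>) = map (f \<circ> frontier_subst \<psi> ts) (frontier \<psi>)"
    using assms(2) by (simp add: frontier_subst_map flip: map_map)
  then show "frontier_subst \<psi> (map f ts) x = (f \<circ> frontier_subst \<psi> ts) x"
    if "x \<in> set (frontier \<psi>)" for x
    using that by simp
qed

lemma birth_apply_map_cases: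
  "A \<in> birth (apply_map g t) \<Longrightarrow> R_term R t \<Longrightarrow>
     A \<in> map_atom (apply_map g) ` birth t \<or>
     (\<exists>c. Base c \<in> term_skel t \<and> A \<in> birth (apply_map g (Base c)))"
proof (induction t rule: term_skel.induct)
  case (2 \<psi> i y ts)
  have R: "i < branching \<psi>" "length ts = length (frontier \<psi>)" "\<forall>t\<in>set ts. R_term R t"
    using 2(3) by (auto simp del: R_term.simps simp: R_term_Sk)
  have "out i (\<psi>, frontier_subst \<psi> (map (apply_map g) ts))
      = map_atom (apply_map g) ` out i (\<psi>, frontier_subst \<psi> ts)"
    by (simp add: frontier_subst_apply_map[OF R(1,2)] map_out_apply_map)
  then show ?case using 2(1,2) R(3) by (fastforce simp: image_Un image_UN)
qed simp

section \<open>Unblockability on branches\<close>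

text \<open>The values of \<open>h_uc\<close> outside the skeleton. That a skeleton is disjoint from
  this set expresses the freshness of these constants.\<close>

definition reserved :: "gterm set" where
  "reserved = insert (Base Star) (range (\<lambda>f. Base (CFun f)))"

lemma h_uc_skel: "t \<in> skel \<tau> \<Longrightarrow> h_uc \<tau> t = t"
  by (simp add: h_uc_def)

lemma h_uc_reserved: "t \<in> reserved \<Longrightarrow> h_uc \<tau> t = t"
  by (auto simp: h_uc_def reserved_def)

lemma h_uc_cases:
  obtains "h_uc \<tau> t \<in> skel \<tau>" "h_uc \<tau> t = t" | "h_uc \<tau> t \<in> reserved"
  by (cases "t \<in> skel \<tau>") (auto simp: h_uc_def reserved_def split: trm.splits const.splits)

lemma h_uc_range: "h_uc \<tau> t \<in> skel \<tau> \<union> reserved"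
  by (cases \<tau> t rule: h_uc_cases) auto

lemma h_uc_idem: "h_uc \<tau> (h_uc \<tau> t) = h_uc \<tau> t"
  by (cases \<tau> t rule: h_uc_cases) (auto simp: h_uc_reserved)

lemma h_uc_Func: "Func f ts \<notin> skel \<tau> \<Longrightarrow> h_uc \<tau> (Func f ts) = Base (CFun f)"
  by (simp add: h_uc_def)

lemma R_term_reserved: "t \<in> reserved \<Longrightarrow> R_term R t"
  by (auto simp: reserved_def)

lemma R_term_h_uc: "R_term R t \<Longrightarrow> R_term R (h_uc \<tau> t)"
  by (cases \<tau> t rule: h_uc_cases) (auto simp: R_term_reserved)

section \<open>Facts over constants and the overapproximation\<close>

lemma const_factsI:
  assumes "atom_pred A \<in> preds R" "\<And>t. t \<in> set_atom A \<Longrightarrow> \<exists>c\<in>C. t = Base c"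
  shows "A \<in> const_facts R C"
proof -
  have "\<forall>t. t \<in> set (args A) \<longrightarrow> (\<exists>c. c \<in> C \<and> t = Base c)"
    using assms(2) by (auto simp: set_atom_args)
  then obtain f where f: "\<And>t. t \<in> set (args A) \<Longrightarrow> f t \<in> C \<and> t = Base (f t)"
    by metis
  have "args A = map Base (map f (args A))"
    using f by (auto simp: list_eq_iff_nth_eq)
  then have "A = Atom (pred_of A) (map Base (map f (args A)))"
    by (metis atom.collapse)
  moreover have "(pred_of A, length (map f (args A))) \<in> preds R" "set (map f (args A)) \<subseteq> C"
    using assms(1) f by (auto simp: atom_pred_def)
  ultimately show ?thesis unfolding const_facts_def by blast
qed

lemma atom_pred_map [simp]: "atom_pred (map_atom f A) = atom_pred A"
  by (simp add: atom_pred_def atom.map_sel)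

lemma const_factsD:
  assumes "A \<in> const_facts R C"
  shows "atom_pred A \<in> preds R" "set_atom A \<subseteq> Base ` C"
proof -
  obtain p cs where "A = Atom p (map Base cs)" "(p, length cs) \<in> preds R" "set cs \<subseteq> C"
    using assms unfolding const_facts_def by blast
  then show "atom_pred A \<in> preds R" "set_atom A \<subseteq> Base ` C"
    by (auto simp: atom_pred_def)
qed

lemma overapprox_const:
  "const_facts R ({c. Base c \<in> skel \<tau>} \<union> {Star}) \<subseteq> overapprox R hc \<tau> h"
  by (auto simp: overapprox_def)

lemma overapprox_birth: "birth_trg \<tau> \<subseteq> overapprox R hc \<tau> h"
  by (auto simp: overapprox_def)

text \<open>Loadedness is monotone: a trigger loaded for the intersection is loaded for each of the
  intersected sets, so the image of its output lies in all of them.\<close>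

lemma overapprox_step:
  assumes "R_trigger R \<tau>'" "loaded \<tau>' (overapprox R hc \<tau> h)" "out_hc hc \<tau>' \<noteq> out_hc hc \<tau>"
  shows "map_atom h ` out_hc hc \<tau>' \<subseteq> overapprox R hc \<tau> h"
  using assms unfolding overapprox_def loaded_def
  by (intro Inter_greatest) blast

lemma overapprox_least:
  assumes "const_facts R ({c. Base c \<in> skel \<tau>} \<union> {Star}) \<subseteq> F"
    and "birth_trg \<tau> \<subseteq> F"
    and "\<And>\<tau>'. R_trigger R \<tau>' \<Longrightarrow> loaded \<tau>' F \<Longrightarrow> out_hc hc \<tau>' \<noteq> out_hc hc \<tau> \<Longrightarrow>
      map_atom h ` out_hc hc \<tau>' \<subseteq> F"
  shows "overapprox R hc \<tau> h \<subseteq> F"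
  using assms unfolding overapprox_def by (intro Inter_lower) blast

text \<open>Equal outputs have equal arguments, and each argument of
  \<open>out i (\<rho>, \<sigma>)\<close> is a frontier value or a Skolem term over frontier values.
  A reserved constant is never such a Skolem term, which forces the relevant values of
  \<open>\<mu>\<close> into the skeleton. The purpose is to show that a trigger does not acquire the
  excluded output when its substitution is composed with \<open>h_uc\<close> or with an inverse of
  \<open>g\<close>.\<close>

lemma out_eq_imp_skel:
  assumes R: "R_trigger R (\<rho>, \<sigma>)" and i: "i < branching \<rho>"
    and eq: "out j (\<psi>, \<mu>) = out i (\<rho>, \<sigma>)"
    and \<mu>: "\<And>x. x \<in> uvars \<psi> \<Longrightarrow> \<mu> x \<in> skel (\<rho>, \<sigma>) \<union> reserved"
    and x: "x \<in> head_vars \<psi> j"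
  shows "if x \<in> uvars \<psi> then \<mu> x \<in> skel (\<rho>, \<sigma>) else \<forall>z\<in>set (frontier \<psi>). \<mu> z \<in> skel (\<rho>, \<sigma>)"
proof -
  have "head_val \<psi> j \<mu> x \<in> head_val \<rho> i \<sigma> ` head_vars \<rho> i"
    using args_out[of j \<psi> \<mu>] args_out[of i \<rho> \<sigma>] eq x by auto
  then obtain x' where x': "x' \<in> head_vars \<rho> i" "head_val \<psi> j \<mu> x = head_val \<rho> i \<sigma> x'"
    by auto
  have fr: "\<sigma> z \<in> skel (\<rho>, \<sigma>)" if "z \<in> set (frontier \<rho>)" for z
    using skel_frontier[OF R that] .
  have args: "t \<in> skel (\<rho>, \<sigma>)" if "head_val \<psi> j \<mu> x = Func f ts" "t \<in> set ts" for f ts t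
    using i x'(1)
  proof (cases rule: head_vars_cases[where \<sigma> = \<sigma>])
    case 1
    then show ?thesis using fr[OF 1(1)] that x'(2) skel_args[OF R] by metis
  next
    case 2
    then show ?thesis using that x'(2) fr by auto
  qed
  show ?thesis
  proof (cases "x \<in> uvars \<psi>")
    case True
    then have hx: "head_val \<psi> j \<mu> x = \<mu> x" by (simp add: head_val_def)
    show ?thesis
      using i x'(1)
    proof (cases rule: head_vars_cases[where \<sigma> = \<sigma>])
      case 1
      then show ?thesis using fr[OF 1(1)] x'(2) hx True by simp
    next
      case 2
      then have "\<mu> x \<notin> reserved" using x'(2) hx by (auto simp: reserved_def)
      then show ?thesis using \<mu>[OF True] True by simp
    qed
  next
    case False
    then show ?thesis using args by (simp add: head_val_def)
  qed
qed

section \<open>Labels along a branch\<close>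

lemma branch_verts: "v \<in> branch T hc \<Longrightarrow> chase_tree K T \<Longrightarrow> v \<in> verts T"
  by (induction rule: branch.induct) (auto simp: chase_tree_def split: prod.splits)

lemma chase_step_ok:
  assumes "chase_tree (R, D) T" "v @ [i] \<in> verts T"
  shows "step_ok R T v"
proof -
  have "v \<in> verts T" "leaf_ok R T v \<or> step_ok R T v"
    using assms unfolding chase_tree_def by blast+
  then show ?thesis using assms(2) by (auto simp: leaf_ok_def)
qed

text \<open>Induction along the branch. The trigger applied at a vertex, composed with
  \<open>h_uc\<close>, is loaded for the overapproximation. Its output is not the excluded one,
  since otherwise the original trigger would already have put that output on the branch.\<close>

lemma uc_branch_overapprox:
  assumes T: "chase_tree (R, rule_database \<rho>\<^sub>0) T" and \<rho>\<^sub>0: "\<rho>\<^sub>0 \<in> R"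
    and hc: "is_head_choice R hc" and R: "R_trigger R (\<rho>, \<sigma>)"
    and res: "skel (\<rho>, \<sigma>) \<inter> reserved = {}"
    and no: "\<And>v. v \<in> branch T hc \<Longrightarrow> \<not> out_hc hc (\<rho>, \<sigma>) \<subseteq> lbl T v"
    and v: "v \<in> branch T hc"
  shows "map_atom (h_uc (\<rho>, \<sigma>)) ` lbl T v \<subseteq> overapprox R hc (\<rho>, \<sigma>) (h_uc (\<rho>, \<sigma>))"
    (is "map_atom ?h ` _ \<subseteq> ?O")
  using v
proof induction
  case root
  have "lbl T [] = rule_database \<rho>\<^sub>0" using T by (simp add: chase_tree_def)
  \<comment> \<open>The arguments are constants \<open>CVar x\<close>, which \<open>?h\<close> keeps
    if they are in the skeleton and sends to \<open>Star\<close> otherwise.\<close>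
  moreover have "map_atom ?h A \<in> const_facts R ({c. Base c \<in> skel (\<rho>, \<sigma>)} \<union> {Star})"
    if A: "A \<in> rule_database \<rho>\<^sub>0" for A
  proof (rule const_factsI)
    obtain B where B: "B \<in> set (body \<rho>\<^sub>0)" "A = map_atom \<sigma>_uc B"
      using A by (auto simp: rule_database_def body_inst_def)
    then show "atom_pred (map_atom ?h A) \<in> preds R"
      using \<rho>\<^sub>0 by (auto simp: preds_def)
    fix t assume "t \<in> set_atom (map_atom ?h A)"
    then obtain x where "t = ?h (Base (CVar x))"
      using B(2) by (auto simp: atom.set_map \<sigma>_uc_def)
    then show "\<exists>c\<in>{c. Base c \<in> skel (\<rho>, \<sigma>)} \<union> {Star}. t = Base c"
      by (auto simp: h_uc_def)
  qed
  ultimately show ?case using overapprox_const by fastforce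
next
  case (child v)
  obtain \<psi> \<mu> where trg: "trg T v = (\<psi>, \<mu>)" by (cases "trg T v")
  let ?i = "hc \<psi>"
  have child': "v @ [?i] \<in> verts T" using child(2) trg by simp
  have ok: "step_ok R T v" using chase_step_ok[OF T child'] .
  then have \<mu>R: "R_trigger R (\<psi>, \<mu>)" and ld: "body_inst (\<psi>, \<mu>) \<subseteq> lbl T v"
    and lbl: "lbl T (v @ [?i]) = lbl T v \<union> out_hc hc (\<psi>, \<mu>)"
    using trg child' by (auto simp: step_ok_def loaded_def out_hc_def)
  have i: "?i < branching \<psi>" and \<rho>R: "hc \<rho> < branching \<rho>"
    using hc \<mu>R R by (auto simp: is_head_choice_def R_trigger_def)
  have "v @ [?i] \<in> branch T hc"
    using branch.child[OF child(1)] child(2) trg by simp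
  \<comment> \<open>A value of \<open>?h\<close> in the skeleton is not reserved, so it was not
    introduced by \<open>?h\<close>.\<close>
  have h_skel: "?h t = t" if "?h t \<in> skel (\<rho>, \<sigma>)" for t
    using that res by (cases "(\<rho>, \<sigma>)" t rule: h_uc_cases) auto
  have ne: "out_hc hc (\<psi>, ?h \<circ> \<mu>) \<noteq> out_hc hc (\<rho>, \<sigma>)"
  proof
    assume "out_hc hc (\<psi>, ?h \<circ> \<mu>) = out_hc hc (\<rho>, \<sigma>)"
    then have eq: "out ?i (\<psi>, ?h \<circ> \<mu>) = out (hc \<rho>) (\<rho>, \<sigma>)" by (simp add: out_hc_def)
    have "out ?i (\<psi>, ?h \<circ> \<mu>) = out ?i (\<psi>, \<mu>)"
    proof (rule out_cong_head_val)
      fix x assume "x \<in> head_vars \<psi> ?i"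
      then have "if x \<in> uvars \<psi> then (?h \<circ> \<mu>) x \<in> skel (\<rho>, \<sigma>)
          else \<forall>z\<in>set (frontier \<psi>). (?h \<circ> \<mu>) z \<in> skel (\<rho>, \<sigma>)"
        by (rule out_eq_imp_skel[OF R \<rho>R eq, rotated]) (use h_uc_range in auto)
      then show "head_val \<psi> ?i (?h \<circ> \<mu>) x = head_val \<psi> ?i \<mu> x"
        using h_skel by (auto simp: head_val_def split: if_splits)
    qed
    then have "out_hc hc (\<rho>, \<sigma>) \<subseteq> lbl T (v @ [?i])"
      using eq lbl by (simp add: out_hc_def)
    then show False using no \<open>v @ [?i] \<in> branch T hc\<close> by blast
  qed
  have "R_trigger R (\<psi>, ?h \<circ> \<mu>)"
    using \<mu>R by (auto simp: R_trigger_def R_term_h_uc)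
  moreover have "loaded (\<psi>, ?h \<circ> \<mu>) ?O"
    using ld child.IH by (auto simp: loaded_def body_inst_comp)
  ultimately have sub: "map_atom ?h ` out_hc hc (\<psi>, ?h \<circ> \<mu>) \<subseteq> ?O"
    using ne by (rule overapprox_step)
  have "map_atom ?h ` out ?i (\<psi>, \<mu>) = map_atom ?h ` out ?i (\<psi>, ?h \<circ> \<mu>)"
  proof (rule map_out_cong)
    fix x assume "x \<in> head_vars \<psi> ?i"
    let ?f = "Sk \<psi> ?i x" and ?s = "map \<mu> (frontier \<psi>)" and ?s' = "map (?h \<circ> \<mu>) (frontier \<psi>)"
    \<comment> \<open>If one of the two terms is in the skeleton, then so are its arguments and the
      terms coincide; otherwise both become the constant of their common symbol.\<close>
    have "?h (Func ?f ?s) = ?h (Func ?f ?s')"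
    proof (cases "Func ?f ?s \<in> skel (\<rho>, \<sigma>) \<or> Func ?f ?s' \<in> skel (\<rho>, \<sigma>)")
      case True
      then have "(\<forall>t\<in>set ?s. t \<in> skel (\<rho>, \<sigma>)) \<or> (\<forall>t\<in>set ?s'. t \<in> skel (\<rho>, \<sigma>))"
        using skel_args[OF R] by blast
      then have "?s' = ?s" using h_skel by (auto simp: h_uc_skel)
      then show ?thesis by (simp only:)
    next
      case False
      then show ?thesis by (simp add: h_uc_Func)
    qed
    then show "?h (head_val \<psi> ?i \<mu> x) = ?h (head_val \<psi> ?i (?h \<circ> \<mu>) x)"
      by (simp add: head_val_def h_uc_idem)
  qed
  then have "map_atom ?h ` lbl T (v @ [?i]) \<subseteq> ?O"
    using lbl child.IH sub by (simp add: out_hc_def image_Un)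
  then show ?case using trg by simp
qed

text \<open>Total in the depth: the address is extended even past a leaf, where \<open>trg\<close>
  is arbitrary. As long as it stays in the tree, it lists the vertices of the branch, one for each
  depth.\<close>

primrec branch_path :: "ctree \<Rightarrow> head_choice \<Rightarrow> nat \<Rightarrow> nat list" where
  "branch_path T hc 0 = []"
| "branch_path T hc (Suc n) = branch_path T hc n @ [hc (fst (trg T (branch_path T hc n)))]"

lemma length_branch_path [simp]: "length (branch_path T hc n) = n"
  by (induction n) auto

lemma branch_eq_path: "v \<in> branch T hc \<Longrightarrow> v = branch_path T hc (length v)"
  by (induction rule: branch.induct) auto

lemma chase_parent: "chase_tree K T \<Longrightarrow> v @ [i] \<in> verts T \<Longrightarrow> v \<in> verts T"
  by (cases K) (auto simp: chase_tree_def)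

lemma branch_path_branch:
  assumes "chase_tree K T"
  shows "branch_path T hc n \<in> verts T \<Longrightarrow> branch_path T hc n \<in> branch T hc"
proof (induction n)
  case (Suc n)
  then have "branch_path T hc n \<in> branch T hc"
    using chase_parent[OF assms] by simp
  then show ?case using branch.child Suc.prems by simp
qed (simp add: branch.root)

lemma branch_path_Suc:
  assumes "chase_tree (R, D) T" "branch_path T hc (Suc n) \<in> verts T"
  shows "lbl T (branch_path T hc (Suc n)) =
    lbl T (branch_path T hc n) \<union> out_hc hc (trg T (branch_path T hc n))"
proof -
  let ?v = "branch_path T hc n"
  have "step_ok R T ?v" using chase_step_ok[OF assms(1)] assms(2) by simp
  then show ?thesis using assms(2) unfolding step_ok_def out_hc_def by simp
qed

lemma branch_path_mono:
  assumes "chase_tree (R, D) T"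
  shows "branch_path T hc n \<in> verts T \<Longrightarrow> m \<le> n \<Longrightarrow>
    branch_path T hc m \<in> verts T \<and> lbl T (branch_path T hc m) \<subseteq> lbl T (branch_path T hc n)"
proof (induction n)
  case (Suc n)
  have "branch_path T hc n \<in> verts T"
    using chase_parent[OF assms] Suc.prems(1) by simp
  then show ?case
    using Suc branch_path_Suc[OF assms Suc.prems(1)] by (cases "m = Suc n") auto
qed simp

text \<open>A branch either has a vertex at the depth given by fairness, or ends before it in a leaf that
  satisfies all rules.\<close>

lemma branch_obsolete:
  assumes T: "chase_tree (R, D) T" and hc: "is_head_choice R hc" and \<tau>: "R_trigger R \<tau>"
    and v: "v \<in> branch T hc" and ld: "loaded \<tau> (lbl T v)"
  obtains u where "u \<in> branch T hc" "obsolete \<tau> (lbl T u)"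
proof -
  let ?p = "branch_path T hc"
  define n where "n = length v"
  have vn: "v = ?p n" using branch_eq_path[OF v] by (simp add: n_def)
  have vT: "v \<in> verts T" using branch_verts[OF v T] .
  have "fair R T" using T by (simp add: chase_tree_def)
  then obtain k where k: "\<And>w. length w = k \<Longrightarrow> v @ w \<in> verts T \<Longrightarrow> obsolete \<tau> (lbl T (v @ w))"
    using vT \<tau> ld unfolding fair_def by blast
  show thesis
  proof (cases "?p (n + k) \<in> verts T")
    case True
    have "\<exists>w. length w = j \<and> ?p (n + j) = v @ w" for j
      using vn by (induction j) auto
    then have "obsolete \<tau> (lbl T (?p (n + k)))" using k True by metis
    then show ?thesis using that branch_path_branch[OF T True] by blast
  next
    case False
    have "?p (n + 0) \<in> verts T" using vn vT by simp
    \<comment> \<open>The last vertex before the path leaves the tree. It must be a leaf, because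
      the head-choice selects an existing child at every vertex where a trigger is applied.\<close>
    then obtain m where m: "?p (n + m) \<in> verts T" "?p (Suc (n + m)) \<notin> verts T"
      using False nat_induct[of "\<lambda>m. ?p (n + m) \<in> verts T" k] by auto
    let ?u = "?p (n + m)"
    obtain \<psi> \<mu> where trg: "trg T ?u = (\<psi>, \<mu>)" by fastforce
    have "\<not> step_ok R T ?u"
    proof
      assume ok: "step_ok R T ?u"
      then have "hc \<psi> < branching \<psi>"
        using hc trg by (auto simp: step_ok_def R_trigger_def is_head_choice_def)
      then show False using ok m(2) trg by (simp add: step_ok_def)
    qed
    then have "leaf_ok R T ?u" using T m(1) by (auto simp: chase_tree_def)
    moreover have "lbl T v \<subseteq> lbl T ?u" using branch_path_mono[OF T m(1), of n] vn by simp
    ultimately have "obsolete \<tau> (lbl T ?u)"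
      using \<tau> ld by (cases \<tau>) (auto simp: leaf_ok_def satisfies_def R_trigger_def loaded_def)
    then show ?thesis using that branch_path_branch[OF T m(1)] by blast
  qed
qed

section \<open>From obsolete triggers to unblockability\<close>

lemma obsolete_datalog:
  assumes "datalog \<rho>" "obsolete (\<rho>, \<sigma>) F"
  shows "out 0 (\<rho>, \<sigma>) \<subseteq> F"
proof -
  obtain \<sigma>' where \<sigma>': "\<forall>x\<in>uvars \<rho>. \<sigma>' x = \<sigma> x" "map_atom \<sigma>' ` set (heads \<rho> ! 0) \<subseteq> F"
    using assms by (auto simp: obsolete_def datalog_def)
  have "out 0 (\<rho>, \<sigma>) = map_atom \<sigma>' ` set (heads \<rho> ! 0)"
    unfolding out_eq
  proof (intro image_cong refl atom.map_cong)
    fix A x assume "A \<in> set (heads \<rho> ! 0)" "x \<in> set_atom A"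
    then have "x \<in> uvars \<rho>"
      using assms(1) exvars_iff[of x \<rho> 0] by (auto simp: datalog_def head_varsI)
    then show "head_val \<rho> 0 \<sigma> x = \<sigma>' x" using \<sigma>'(1) by (simp add: head_val_def)
  qed
  then show ?thesis using \<sigma>'(2) by simp
qed

text \<open>The existential values of the witness are composed with \<open>k\<close>. Body variables
  that occur in a disjunct are frontier variables, so \<open>k\<close> has to respect the
  substitutions only there.\<close>

lemma obsolete_map:
  assumes ob: "obsolete (\<rho>, \<sigma>') F" and F: "map_atom k ` F \<subseteq> G"
    and k: "\<And>x. x \<in> set (frontier \<rho>) \<Longrightarrow> k (\<sigma>' x) = \<sigma> x"
  shows "obsolete (\<rho>, \<sigma>) G"
proof -
  obtain \<theta> i where \<theta>: "\<forall>x\<in>uvars \<rho>. \<theta> x = \<sigma>' x" and i: "i < branching \<rho>"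
    and sub: "map_atom \<theta> ` set (heads \<rho> ! i) \<subseteq> F"
    using ob by (auto simp: obsolete_def)
  let ?\<theta>' = "\<lambda>x. if x \<in> uvars \<rho> then \<sigma> x else k (\<theta> x)"
  have "map_atom ?\<theta>' ` set (heads \<rho> ! i) = map_atom k ` map_atom \<theta> ` set (heads \<rho> ! i)"
    unfolding image_image atom.map_comp
  proof (intro image_cong refl atom.map_cong)
    fix A x assume "A \<in> set (heads \<rho> ! i)" "x \<in> set_atom A"
    then have "x \<in> uvars \<rho> \<Longrightarrow> x \<in> set (frontier \<rho>)"
      using i by (auto simp: frontier_iff head_varsI)
    then show "?\<theta>' x = (k \<circ> \<theta>) x" using k \<theta> by auto
  qed
  then have "map_atom ?\<theta>' ` set (heads \<rho> ! i) \<subseteq> G" using sub F by blast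
  then show ?thesis using i unfolding obsolete_def by (auto intro!: exI[of _ ?\<theta>'])
qed

text \<open>Fairness makes the trigger obsolete somewhere on the branch. For a datalog rule this
  means that the output is present; otherwise, were the output absent, \<open>h_uc\<close> would
  transfer obsolescence to the overapproximation, as it fixes the frontier values.\<close>

lemma uc_unblockable_imp_g_unblockable:
  assumes \<rho>\<^sub>0: "\<rho>\<^sub>0 \<in> R" and hc: "is_head_choice R hc" and R: "R_trigger R (\<rho>, \<sigma>)"
    and res: "skel (\<rho>, \<sigma>) \<inter> reserved = {}" and uc: "uc_unblockable R hc (\<rho>, \<sigma>)"
  shows "g_unblockable (R, rule_database \<rho>\<^sub>0) hc (\<rho>, \<sigma>)"
  unfolding g_unblockable_def
proof (intro allI impI ballI)
  fix T v assume T: "chase_tree (R, rule_database \<rho>\<^sub>0) T"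
    and v: "v \<in> branch T hc" and ld: "loaded (\<rho>, \<sigma>) (lbl T v)"
  obtain u where u: "u \<in> branch T hc" "obsolete (\<rho>, \<sigma>) (lbl T u)"
    using branch_obsolete[OF T hc R v ld] .
  show "\<exists>u\<in>branch T hc. out_hc hc (\<rho>, \<sigma>) \<subseteq> lbl T u"
  proof (cases "datalog \<rho>")
    case True
    have "hc \<rho> = 0"
      using True hc R by (auto simp: is_head_choice_def R_trigger_def datalog_def)
    then show ?thesis using obsolete_datalog[OF True u(2)] u(1) by (auto simp: out_hc_def)
  next
    case False
    show ?thesis
    proof (rule ccontr)
      assume "\<not> ?thesis"
      then have "map_atom (h_uc (\<rho>, \<sigma>)) ` lbl T u \<subseteq> overapprox R hc (\<rho>, \<sigma>) (h_uc (\<rho>, \<sigma>))"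
        using uc_branch_overapprox[OF T \<rho>\<^sub>0 hc R res] u(1) by blast
      then have "obsolete (\<rho>, \<sigma>) (overapprox R hc (\<rho>, \<sigma>) (h_uc (\<rho>, \<sigma>)))"
        using obsolete_map[OF u(2)] skel_frontier[OF R] h_uc_skel by metis
      then show False using uc False by (simp add: uc_unblockable_def)
    qed
  qed
qed

text \<open>If all frontier variables are mapped to constants, the facts over the constants of the skeleton
  and \<open>Star\<close> already satisfy every disjunct.\<close>

lemma uc_unblockable_functional:
  assumes R: "R_trigger R (\<rho>, \<sigma>)" and hc: "is_head_choice R hc"
    and uc: "uc_unblockable R hc (\<rho>, \<sigma>)" and nd: "\<not> datalog \<rho>"
  obtains (functional) x f ts where "x \<in> set (frontier \<rho>)" "\<sigma> x = Func f ts"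
proof (rule ccontr)
  assume "\<not> thesis"
  with functional have const: "\<exists>c. \<sigma> x = Base c" if "x \<in> set (frontier \<rho>)" for x
    using that by (cases "\<sigma> x") auto
  let ?\<theta> = "\<lambda>x. if x \<in> uvars \<rho> then \<sigma> x else Base Star"
  let ?C = "{c. Base c \<in> skel (\<rho>, \<sigma>)} \<union> {Star}"
  have \<rho>: "\<rho> \<in> R" "hc \<rho> < branching \<rho>"
    using R hc by (auto simp: R_trigger_def is_head_choice_def)
  have "map_atom ?\<theta> A \<in> const_facts R ?C" if A: "A \<in> set (heads \<rho> ! hc \<rho>)" for A
  proof (rule const_factsI)
    show "atom_pred (map_atom ?\<theta> A) \<in> preds R" using head_preds[OF \<rho> A] by simp
    fix t assume "t \<in> set_atom (map_atom ?\<theta> A)"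
    then obtain x where x: "x \<in> set_atom A" "t = ?\<theta> x" by (auto simp: atom.set_map)
    show "\<exists>c\<in>?C. t = Base c"
    proof (cases "x \<in> uvars \<rho>")
      case True
      then have "x \<in> set (frontier \<rho>)"
        using x(1) A \<rho>(2) by (auto simp: frontier_iff head_varsI)
      then show ?thesis using const[of x] skel_frontier[OF R, of x] x(2) True by fastforce
    qed (use x in auto)
  qed
  then have "map_atom ?\<theta> ` set (heads \<rho> ! hc \<rho>) \<subseteq> overapprox R hc (\<rho>, \<sigma>) (h_uc (\<rho>, \<sigma>))"
    using overapprox_const by fast
  then have "obsolete (\<rho>, \<sigma>) (overapprox R hc (\<rho>, \<sigma>) (h_uc (\<rho>, \<sigma>)))"
    using \<rho>(2) unfolding obsolete_def by (auto intro!: exI[of _ ?\<theta>])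
  then show False using uc nd by (simp add: uc_unblockable_def)
qed

section \<open>Shifting triggers along a reversible map\<close>

lemma uc_unblockable_shift:
  assumes R: "R_trigger R (\<rho>, \<sigma>)" and R': "R_trigger R (\<rho>, apply_map g \<circ> \<sigma>)"
    and gR: "\<And>c t. g c = Some t \<Longrightarrow> R_term R t"
    and hc: "is_head_choice R hc"
    and res: "skel (\<rho>, \<sigma>) \<inter> reserved = {}"
    and res': "skel (\<rho>, apply_map g \<circ> \<sigma>) \<inter> reserved = {}"
    and rev: "reversible g (skel (\<rho>, \<sigma>))"
    and uc: "uc_unblockable R hc (\<rho>, \<sigma>)"
  shows "uc_unblockable R hc (\<rho>, apply_map g \<circ> \<sigma>)"
proof -
  let ?g = "apply_map g"
  let ?l = "(\<rho>, \<sigma>)" and ?l' = "(\<rho>, ?g \<circ> \<sigma>)"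
  let ?h = "h_uc ?l" and ?h' = "h_uc ?l'"
  let ?S = "skel ?l" and ?S' = "skel ?l'"
  let ?O = "overapprox R hc ?l ?h" and ?O' = "overapprox R hc ?l' ?h'"
  let ?C = "{c. Base c \<in> ?S} \<union> {Star}"
  \<comment> \<open>A left inverse of \<open>?g\<close> on the skeleton that keeps the other
    reserved constants and collapses all remaining terms to \<open>Star\<close>. The goal is that it
    maps \<open>?O'\<close> into \<open>?O\<close>.\<close>
  define k where "k u = (if u \<in> ?g ` ?S then the_inv_into ?S ?g u
    else if u \<in> reserved then u else Base Star)" for u
  have g_R: "R_term R (?g t)" if "R_term R t" for t
    using that by (rule R_term_apply_map[rotated]) (rule gR)
  have inj: "inj_on ?g ?S" using rev by (simp add: reversible_def)
  have gS: "?g t \<in> ?S'" if "t \<in> ?S" for t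
    using that term_skel_apply_map_image g_R[OF skel_R_term[OF R that]]
    unfolding skel_eq[OF R] skel_eq[OF R'] by fastforce
  have k_g: "k (?g t) = t" if "t \<in> ?S" for t
    using that inj by (simp add: k_def the_inv_into_f_f)
  have k_res: "k u = u" if "u \<in> reserved" for u
    using that gS res' by (auto simp: k_def)
  have k_cases: "k u \<in> ?S \<and> ?g (k u) = u \<or> k u \<in> reserved" for u
    using k_g by (auto simp: k_def[of u] reserved_def inj the_inv_into_f_f)
  have k_skel: "?g (k u) = u" if "k u \<in> ?S" for u
    using that k_cases[of u] res by blast
  have k_range: "k u \<in> ?S \<union> reserved" for u
    using k_cases[of u] by blast
  have h_k: "?h (k u) = k u" for u
    using k_range[of u] h_uc_skel h_uc_reserved by blast
  have k_R: "R_term R (k u)" for u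
    using k_range[of u] skel_R_term[OF R] R_term_reserved by blast
  \<comment> \<open>Facts over such terms are mapped to facts over \<open>?C\<close>, all of which
    \<open>?O\<close> contains from the start.\<close>
  have k_Base: "\<exists>c\<in>?C. k u = Base c"
    if "\<And>f ts. Func f ts \<in> ?S \<Longrightarrow> ?g (Func f ts) \<noteq> u" "u \<in> ?S' \<or> u = Base Star" for u
  proof (cases "u \<in> ?g ` ?S")
    case True
    then obtain t where "t \<in> ?S" "u = ?g t" by blast
    then show ?thesis using that(1) k_g by (cases t) auto
  next
    case False
    then show ?thesis using that(2) res' by (auto simp: k_def)
  qed

  text \<open>The third condition of reversibility concerns subterms of \<open>g c\<close>; it extends to the skeleton
    of \<open>g c\<close> because skeletons are closed under terms created by the same disjunct.\<close>

  have new: "?g (Func f ts) \<notin> term_skel (?g (Base c))"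
    if c: "Base c \<in> ?S" and f: "Func f ts \<in> ?S" for c f ts
  proof
    assume *: "?g (Func f ts) \<in> term_skel (?g (Base c))"
    obtain \<psi> i y where fS: "f = Sk \<psi> i y" by (cases f)
    have "R_term R (?g (Base c))" by (rule g_R) simp
    then obtain y' where y': "y' \<in> exvars \<psi> i"
      "Func (Sk \<psi> i y') (map ?g ts) \<in> subterms (?g (Base c))"
      using term_skel_sibling[of \<psi> i y "map ?g ts"] * fS by auto
    have "Func (Sk \<psi> i y') ts \<in> ?S"
      using skel_closed[OF R f] y'(1) by (auto simp: fS)
    then show False using rev c y'(2) unfolding reversible_def by fastforce
  qed
  have skel_gc: "term_skel (?g (Base c)) \<subseteq> ?S'" if "Base c \<in> ?S" for c
    using skel_closed[OF R' gS[OF that]] .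
  \<comment> \<open>By \<open>new\<close>, no argument of these facts is the image of a functional
    term of \<open>?S\<close>, so \<open>k\<close> turns them into facts over constants.\<close>
  have birth_gc: "map_atom k A \<in> ?O" if c: "Base c \<in> ?S" and A: "A \<in> birth (?g (Base c))" for A c
  proof -
    have Rc: "R_term R (?g (Base c))" by (rule g_R) simp
    have "map_atom k A \<in> const_facts R ?C"
    proof (rule const_factsI)
      show "atom_pred (map_atom k A) \<in> preds R" using birth_preds[OF Rc A] by simp
      fix t assume "t \<in> set_atom (map_atom k A)"
      then obtain u where u: "u \<in> set_atom A" "t = k u" by (auto simp: atom.set_map)
      then have "u \<in> term_skel (?g (Base c))" using args_birth[OF Rc A] by blast
      then show "\<exists>c\<in>?C. t = Base c"
        unfolding u(2) using new[OF c] skel_gc[OF c] by (intro k_Base) auto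
    qed
    then show ?thesis using overapprox_const by blast
  qed
  \<comment> \<open>The bound on the arguments is part of the invariant because it makes
    \<open>?h'\<close> the identity on the values of triggers loaded for \<open>F\<close>.\<close>
  define F where "F = {A. set_atom A \<subseteq> ?S' \<union> reserved \<and> map_atom k A \<in> ?O}"
  have "?O' \<subseteq> F"
  proof (rule overapprox_least)
    show "const_facts R ({c. Base c \<in> ?S'} \<union> {Star}) \<subseteq> F"
    proof
      fix A assume A: "A \<in> const_facts R ({c. Base c \<in> ?S'} \<union> {Star})"
      then have args: "\<exists>c. u = Base c \<and> (u \<in> ?S' \<or> u = Base Star)" if "u \<in> set_atom A" for u
        using const_factsD(2)[OF A] that by auto
      have "map_atom k A \<in> const_facts R ?C"
      proof (rule const_factsI)
        show "atom_pred (map_atom k A) \<in> preds R" using const_factsD(1)[OF A] by simp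
        fix t assume "t \<in> set_atom (map_atom k A)"
        then obtain u where u: "u \<in> set_atom A" "t = k u" by (auto simp: atom.set_map)
        then show "\<exists>c\<in>?C. t = Base c"
          unfolding u(2) using args[OF u(1)] by (intro k_Base) auto
      qed
      then show "A \<in> F"
        using args overapprox_const unfolding F_def by (fastforce simp: reserved_def)
    qed
    show "birth_trg ?l' \<subseteq> F"
    proof
      fix A assume "A \<in> birth_trg ?l'"
      then obtain x where x: "x \<in> set (frontier \<rho>)" "A \<in> birth (?g (\<sigma> x))"
        by (auto simp: birth_trg_def)
      have Rx: "R_term R (\<sigma> x)" using R frontier_uvars[OF x(1)] by (auto simp: R_trigger_def)
      have sk: "term_skel (\<sigma> x) \<subseteq> ?S" using skel_closed[OF R skel_frontier[OF R x(1)]] .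
      have "set_atom A \<subseteq> term_skel (?g (\<sigma> x))"
        using args_birth[OF g_R[OF Rx] x(2)] by blast
      also have "\<dots> \<subseteq> ?S'" using skel_closed[OF R' skel_frontier[OF R' x(1)]] by simp
      finally have args: "set_atom A \<subseteq> ?S'" .
      have "map_atom k A \<in> ?O"
        using birth_apply_map_cases[OF x(2) Rx]
      proof (elim disjE exE conjE)
        assume "A \<in> map_atom ?g ` birth (\<sigma> x)"
        then obtain B where B: "B \<in> birth (\<sigma> x)" "A = map_atom ?g B" by blast
        have "map_atom (k \<circ> ?g) B = map_atom id B"
          using args_birth[OF Rx B(1)] sk k_g by (intro atom.map_cong) auto
        then have "map_atom k A = B" by (simp add: B(2) atom.map_comp atom.map_id)
        then show ?thesis
          using B(1) x(1) overapprox_birth[of ?l R hc ?h] by (auto simp: birth_trg_def)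
      next
        fix c assume "Base c \<in> term_skel (\<sigma> x)" "A \<in> birth (?g (Base c))"
        then show ?thesis using birth_gc sk by blast
      qed
      then show "A \<in> F" using args by (auto simp: F_def)
    qed
    fix \<tau>' assume \<tau>': "R_trigger R \<tau>'" "loaded \<tau>' F" "out_hc hc \<tau>' \<noteq> out_hc hc ?l'"
    obtain \<psi> \<mu> where \<tau>: "\<tau>' = (\<psi>, \<mu>)" by (cases \<tau>')
    let ?i = "hc \<psi>" and ?ts = "map \<mu> (frontier \<psi>)"
    have i: "?i < branching \<psi>" and \<rho>R: "hc \<rho> < branching \<rho>"
      using hc \<tau>'(1) R by (auto simp: \<tau> is_head_choice_def R_trigger_def)
    have \<mu>: "\<mu> x \<in> ?S' \<union> reserved" if "x \<in> uvars \<psi>" for x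
    proof -
      have "\<mu> x \<in> (\<Union>A\<in>body_inst (\<psi>, \<mu>). set_atom A)" using that by (simp add: args_body_inst)
      then show ?thesis using \<tau>'(2) unfolding loaded_def \<tau> F_def by blast
    qed
    have h'_\<mu>: "?h' (\<mu> x) = \<mu> x" if "x \<in> uvars \<psi>" for x
      using \<mu>[OF that] h_uc_skel h_uc_reserved by blast

    text \<open>\<open>k\<close> commutes with the outputs of triggers unless these create terms of the skeleton of some
      \<open>g c\<close>; in that case the whole output consists of birth facts of \<open>g c\<close>.\<close>

    have k_out: "map_atom k ` map_atom ?h' ` out ?i (\<psi>, \<mu>) \<subseteq> ?O"
    proof (cases "\<exists>c y. Base c \<in> ?S \<and> Func (Sk \<psi> ?i y) ?ts \<in> term_skel (?g (Base c))")
      case True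
      then obtain c y where c: "Base c \<in> ?S" "Func (Sk \<psi> ?i y) ?ts \<in> term_skel (?g (Base c))"
        by blast
      have "map (frontier_subst \<psi> ?ts) (frontier \<psi>) = ?ts" by (rule frontier_subst_map) simp
      then have "out ?i (\<psi>, frontier_subst \<psi> ?ts) = out ?i (\<psi>, \<mu>)"
        by (intro out_cong[OF i]) simp
      then have sub: "out ?i (\<psi>, \<mu>) \<subseteq> birth (?g (Base c))" using birth_out[OF c(2)] by simp
      have "map_atom ?h' A = A" if "A \<in> out ?i (\<psi>, \<mu>)" for A
      proof -
        have "R_term R (?g (Base c))" by (rule g_R) simp
        then have "set_atom A \<subseteq> ?S'" using args_birth sub that skel_gc[OF c(1)] by blast
        then have "map_atom ?h' A = map_atom id A"
          by (intro atom.map_cong) (auto simp: h_uc_skel)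
        then show ?thesis by (simp add: atom.map_id)
      qed
      then show ?thesis using birth_gc[OF c(1)] sub by auto
    next
      case False
      \<comment> \<open>For Skolem terms: if the term over the values of \<open>k\<close> is in
        \<open>?S\<close>, then \<open>?g\<close> maps it to the given one and \<open>k\<close> maps
        it back. Otherwise neither term is in its skeleton, and both become the constant of their
        symbol, which \<open>k\<close> fixes.\<close>
      have k_h': "k (?h' (head_val \<psi> ?i \<mu> x)) = ?h (head_val \<psi> ?i (k \<circ> \<mu>) x)" for x
      proof (cases "x \<in> uvars \<psi>")
        case True
        then show ?thesis by (simp add: head_val_def h'_\<mu> h_k)
      next
        case x: False
        let ?f = "Sk \<psi> ?i x" and ?ts' = "map (k \<circ> \<mu>) (frontier \<psi>)"
        have "k (?h' (Func ?f ?ts)) = ?h (Func ?f ?ts')"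
        proof (cases "Func ?f ?ts' \<in> ?S")
          case True
          then have "?g (k (\<mu> z)) = \<mu> z" if "z \<in> set (frontier \<psi>)" for z
            using skel_args[OF R True, of "k (\<mu> z)"] k_skel that by simp
          then have eq: "?g (Func ?f ?ts') = Func ?f ?ts" by simp
          then have "?h' (Func ?f ?ts) = ?g (Func ?f ?ts')"
            using gS[OF True] h_uc_skel by metis
          then show ?thesis using k_g[OF True] h_uc_skel[OF True] by (simp only:)
        next
          case nS: False
          \<comment> \<open>An element of \<open>?S'\<close> is the image of a functional term of
            \<open>?S\<close>, whose arguments \<open>k\<close> recovers from \<open>?ts\<close>, or
            it lies in the skeleton of some \<open>?g\<close> of a constant, which the current case
            excludes.\<close>
          have "Func ?f ?ts \<notin> ?S'"
          proof
            assume "Func ?f ?ts \<in> ?S'"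
            then obtain z where z: "z \<in> set (frontier \<rho>)" "Func ?f ?ts \<in> term_skel (?g (\<sigma> z))"
              by (auto simp: skel_eq[OF R'])
            have sk: "term_skel (\<sigma> z) \<subseteq> ?S" using skel_closed[OF R skel_frontier[OF R z(1)]] .
            show False
              using term_skel_apply_map_cases[OF z(2)]
            proof (elim disjE exE conjE)
              fix f ss assume ss: "Func f ss \<in> term_skel (\<sigma> z)" "Func ?f ?ts = ?g (Func f ss)"
              then have "Func ?f ss \<in> ?S" using sk by auto
              then have "k (?g s) = s" if "s \<in> set ss" for s
                using skel_args[OF R] k_g that by blast
              then have "map k (map ?g ss) = ss" by (simp add: map_idI)
              moreover have "?ts = map ?g ss" using ss(2) by simp
              ultimately have "?ts' = ss" by (metis map_map)
              then show False using nS \<open>Func ?f ss \<in> ?S\<close> by simp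
            next
              fix c assume "Base c \<in> term_skel (\<sigma> z)" "Func ?f ?ts \<in> term_skel (?g (Base c))"
              then show False using False sk by blast
            qed
          qed
          then show ?thesis using nS by (simp add: h_uc_Func k_res reserved_def)
        qed
        then show ?thesis using x by (simp add: head_val_def)
      qed
      \<comment> \<open>Equality would place the relevant values of \<open>k\<close> in
        \<open>?S\<close>, where \<open>?g\<close> undoes \<open>k\<close>; applying
        \<open>?g\<close> to both outputs then gives the equality excluded for
        \<open>\<tau>'\<close>.\<close>
      have ne: "out_hc hc (\<psi>, k \<circ> \<mu>) \<noteq> out_hc hc ?l"
      proof
        assume "out_hc hc (\<psi>, k \<circ> \<mu>) = out_hc hc ?l"
        then have eq: "out ?i (\<psi>, k \<circ> \<mu>) = out (hc \<rho>) ?l" by (simp add: out_hc_def)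
        have "out ?i (\<psi>, ?g \<circ> (k \<circ> \<mu>)) = out ?i (\<psi>, \<mu>)"
        proof (rule out_cong_head_val)
          fix x assume "x \<in> head_vars \<psi> ?i"
          then have "if x \<in> uvars \<psi> then (k \<circ> \<mu>) x \<in> ?S
              else \<forall>z\<in>set (frontier \<psi>). (k \<circ> \<mu>) z \<in> ?S"
            by (rule out_eq_imp_skel[OF R \<rho>R eq, rotated]) (use k_range in auto)
          then show "head_val \<psi> ?i (?g \<circ> (k \<circ> \<mu>)) x = head_val \<psi> ?i \<mu> x"
            using k_skel by (auto simp: head_val_def split: if_splits)
        qed
        then have "out ?i (\<psi>, \<mu>) = map_atom ?g ` out ?i (\<psi>, k \<circ> \<mu>)"
          by (simp add: map_out_apply_map)
        then have "out ?i (\<psi>, \<mu>) = out (hc \<rho>) ?l'"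
          by (simp add: eq map_out_apply_map)
        then show False using \<tau>'(3) by (simp add: \<tau> out_hc_def)
      qed
      have "R_trigger R (\<psi>, k \<circ> \<mu>)"
        using \<tau>'(1) by (auto simp: \<tau> R_trigger_def k_R)
      moreover have "loaded (\<psi>, k \<circ> \<mu>) ?O"
        using \<tau>'(2) unfolding loaded_def \<tau> body_inst_comp F_def by blast
      ultimately have "map_atom ?h ` out_hc hc (\<psi>, k \<circ> \<mu>) \<subseteq> ?O"
        using ne by (rule overapprox_step)
      moreover have "map_atom (k \<circ> ?h') ` out ?i (\<psi>, \<mu>) = map_atom ?h ` out ?i (\<psi>, k \<circ> \<mu>)"
        by (rule map_out_cong) (simp add: k_h')
      ultimately show ?thesis by (simp add: out_hc_def image_image atom.map_comp)
    qed
    have "set_atom (map_atom ?h' A) \<subseteq> ?S' \<union> reserved" for A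
      using h_uc_range by (auto simp: atom.set_map)
    then show "map_atom ?h' ` out_hc hc \<tau>' \<subseteq> F"
      using k_out unfolding F_def \<tau> out_hc_def by auto
  qed
  then have F: "map_atom k ` ?O' \<subseteq> ?O" by (auto simp: F_def)
  have "\<not> obsolete ?l' ?O'" if "\<not> obsolete ?l ?O"
  proof
    assume "obsolete ?l' ?O'"
    then have "obsolete ?l ?O"
      by (rule obsolete_map[OF _ F]) (simp add: k_g skel_frontier[OF R])
    then show False using that by contradiction
  qed
  then show ?thesis using uc by (auto simp: uc_unblockable_def)
qed

section \<open>Cyclicity sequences\<close>

text \<open>In a finite tree the branch has a last vertex, whose label is finite and contains all
  labels of the branch. By loadedness and unblockability it contains every \<open>?F k\<close>,
  whereas growth makes the number of terms of these sets unbounded.\<close>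

lemma cyclicity_sequence_imp_never_terminates:
  assumes db: "database D" and cyc: "cyclicity_sequence (R, D) hc s"
  shows "never_terminates R"
proof -
  let ?F = "facts_after D hc s"
  have False if T: "chase_tree (R, D) T" and fin: "finite (verts T)" for T
  proof -
    let ?p = "branch_path T hc"
    have "inj_on ?p X" for X by (metis inj_onI length_branch_path)
    moreover have "?p ` {n. ?p n \<in> verts T} \<subseteq> verts T" by blast
    ultimately have finN: "finite {n. ?p n \<in> verts T}"
      using fin finite_imageD finite_subset by metis
    have "?p 0 \<in> verts T" using T by (simp add: chase_tree_def)
    then have ne: "{n. ?p n \<in> verts T} \<noteq> {}" by blast
    define N where "N = Max {n. ?p n \<in> verts T}"
    have N: "?p N \<in> verts T" using Max_in[OF finN ne] by (simp add: N_def)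
    have top: "lbl T u \<subseteq> lbl T (?p N)" if "u \<in> branch T hc" for u
    proof -
      have u: "u = ?p (length u)" using branch_eq_path[OF that] .
      then have "length u \<in> {n. ?p n \<in> verts T}" using branch_verts[OF that T] by simp
      then have "length u \<le> N" unfolding N_def using finN by (rule Max_ge[rotated])
      then show ?thesis using branch_path_mono[OF T N] u by metis
    qed
    have "finite (lbl T (?p n))" if "?p n \<in> verts T" for n
      using that
    proof (induction n)
      case 0
      then show ?case using T db by (simp add: chase_tree_def database_def)
    next
      case (Suc n)
      then have "?p n \<in> verts T" using chase_parent[OF T] by simp
      then show ?case
        using Suc branch_path_Suc[OF T Suc.prems] by (simp add: out_hc_def finite_out del: branch_path.simps)
    qed
    then have finL: "finite (terms (lbl T (?p N)))" using N finite_terms by blast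
    have sub: "?F k \<subseteq> lbl T (?p N)" for k
    proof (induction k)
      case 0
      have "lbl T [] = D" using T by (simp add: chase_tree_def)
      then show ?case using top[OF branch.root] by simp
    next
      case (Suc k)
      have "loaded (s k) (?F k)" and unb: "g_unblockable (R, D) hc (s k)"
        using cyc by (auto simp: cyclicity_sequence_def loaded_seq_def)
      then have "loaded (s k) (lbl T (?p N))" using Suc by (auto simp: loaded_def)
      then obtain u where "u \<in> branch T hc" "out_hc hc (s k) \<subseteq> lbl T u"
        using unb T branch_path_branch[OF T N] unfolding g_unblockable_def by blast
      then show ?case using Suc top by auto
    qed
    have mono: "?F i \<subseteq> ?F j" if "i \<le> j" for i j
      using that by (rule lift_Suc_mono_le[rotated]) auto
    have "\<exists>i. k \<le> card (terms (?F i))" for k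
    proof (induction k)
      case (Suc k)
      then obtain i where i: "k \<le> card (terms (?F i))" by blast
      obtain j t where j: "i < j" "t \<in> terms (?F j)" "t \<notin> terms (?F i)"
        using cyc by (fastforce simp: cyclicity_sequence_def growing_seq_def)
      then have "terms (?F i) \<subset> terms (?F j)" using terms_mono[OF mono[of i j]] by auto
      moreover have "finite (terms (?F j))" using finL terms_mono[OF sub] finite_subset by blast
      ultimately have "card (terms (?F i)) < card (terms (?F j))" by (intro psubset_card_mono)
      then show ?case using i by (intro exI[of _ j]) simp
    qed simp
    then obtain i where "Suc (card (terms (lbl T (?p N)))) \<le> card (terms (?F i))" by blast
    moreover have "card (terms (?F i)) \<le> card (terms (lbl T (?p N)))"
      using card_mono[OF finL terms_mono[OF sub]] .
    ultimately show False by simp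
  qed
  then show ?thesis using db by (auto simp: never_terminates_def)
qed

section \<open>Iterated shifts\<close>

lemma shift_trigger_eq: "shift_trigger g j (\<rho>, \<sigma>) = (\<rho>, (apply_map g ^^ j) \<circ> \<sigma>)"
  by (simp add: shift_trigger_def)

lemma shift_trigger_Suc:
  "shift_trigger g (Suc j) (\<rho>, \<sigma>) = (\<rho>, apply_map g \<circ> snd (shift_trigger g j (\<rho>, \<sigma>)))"
  by (simp add: shift_trigger_eq comp_assoc)

lemma funpow_apply_map_Func:
  "(apply_map g ^^ j) (Func f ts) = Func f (map (apply_map g ^^ j) ts)"
  by (induction j) (auto simp: comp_def)

lemma funpow_subterms:
  "s \<in> subterms t \<Longrightarrow> (apply_map g ^^ j) s \<in> subterms ((apply_map g ^^ j) t)"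
  by (induction j) (auto intro: subterms_apply_map)

lemma facts_after_mono: "i \<le> j \<Longrightarrow> facts_after D hc s i \<subseteq> facts_after D hc s j"
  by (rule lift_Suc_mono_le) auto

lemma finite_facts_after: "finite D \<Longrightarrow> finite (facts_after D hc s k)"
  by (induction k) (auto simp: out_hc_def finite_out)

lemma database_rule_database: "database (rule_database \<rho>)"
  by (auto simp: database_def rule_database_def body_inst_def atom.set_map \<sigma>_uc_def)

section \<open>The unfolding of a cyclicity prefix\<close>

locale cyclicity_prefix_unfolding =
  fixes R :: "rule set" and hc :: head_choice and \<rho> :: rule and \<Lambda> :: "trigger list"
  assumes hc: "is_head_choice R hc"
    and \<rho>: "\<rho> \<in> R"
    and prefix: "cyclicity_prefix R hc \<rho> \<Lambda>"
begin

abbreviation "g \<equiv> apply_map (prefix_map \<Lambda>)"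
text \<open>The length of a round. The first trigger has index 0 and lies outside the rounds, so the
  last trigger of the prefix is \<open>s n\<close>.\<close>

definition n where "n = length (tl \<Lambda>)"
abbreviation "D \<equiv> rule_database \<rho>"
abbreviation "s \<equiv> prefix_unfold \<Lambda>"
abbreviation "F \<equiv> facts_after D hc s"
abbreviation "\<sigma>\<^sub>n \<equiv> snd (last \<Lambda>)"

lemma nonempty: "\<Lambda> \<noteq> []"
  and R_triggers: "\<tau> \<in> set \<Lambda> \<Longrightarrow> R_trigger R \<tau>"
  and hd_eq: "hd \<Lambda> = (\<rho>, \<sigma>_uc)"
  and last_eq: "last \<Lambda> = (\<rho>, \<sigma>\<^sub>n)"
  and loaded: "k < length \<Lambda> \<Longrightarrow> loaded (\<Lambda> ! k) (facts_after D hc (nth \<Lambda>) k)"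
  and uc: "\<tau> \<in> set (tl \<Lambda>) \<Longrightarrow> uc_unblockable R hc \<tau>"
  and rev: "\<tau> \<in> set (tl \<Lambda>) \<Longrightarrow> reversible (prefix_map \<Lambda>) (skel (shift_trigger (prefix_map \<Lambda>) j \<tau>))"
  using prefix by (auto simp: cyclicity_prefix_def loaded_list_def prod_eq_iff)

lemma length_eq: "length \<Lambda> = Suc n"
  using nonempty by (simp add: n_def)

lemma s_0: "s 0 = (\<rho>, \<sigma>_uc)"
  by (simp add: prefix_unfold_def hd_eq)

lemma prefix_map_eq: "prefix_map \<Lambda> c =
    (case c of CVar x \<Rightarrow> if x \<in> uvars \<rho> then Some (\<sigma>\<^sub>n x) else None | _ \<Rightarrow> None)"
  by (cases c) (simp_all add: prefix_map_def hd_eq)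

lemma g_uc: "x \<in> uvars \<rho> \<Longrightarrow> g (\<sigma>_uc x) = \<sigma>\<^sub>n x"
  by (simp add: apply_map_def \<sigma>_uc_def prefix_map_eq)

text \<open>The output of the first trigger contains only terms of depth at most one, hence no cyclic one.\<close>

lemma cyclic_rule: "\<not> datalog \<rho>" and n_pos: "n > 0"
proof -
  obtain f ts u where t: "Func f ts \<in> terms (out_hc hc (last \<Lambda>))"
    and f: "f \<in> sk_funs \<rho>" and u: "u \<in> set ts" "f \<in> funs u"
    using prefix by (auto simp: cyclicity_prefix_def rule_cyclic_def)
  then show "\<not> datalog \<rho>" by (auto simp: sk_funs_def datalog_def)
  show "n > 0"
  proof (rule ccontr)
    assume "\<not> n > 0"
    then obtain \<tau> where "\<Lambda> = [\<tau>]" using length_eq by (auto simp: length_Suc_conv)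
    then have "last \<Lambda> = (\<rho>, \<sigma>_uc)" using hd_eq by simp
    then have "Func f ts \<in> terms (out (hc \<rho>) (\<rho>, \<sigma>_uc))" using t by (simp add: out_hc_def)
    then show False
      using u by (cases rule: terms_out_cases) (auto simp: \<sigma>_uc_def)
  qed
qed

lemma last_in_tl: "last \<Lambda> \<in> set (tl \<Lambda>)"
proof -
  have "tl \<Lambda> \<noteq> []" using n_pos by (metis length_greater_0_conv n_def)
  then show ?thesis using last_tl[of \<Lambda>] last_in_set[of "tl \<Lambda>"] by simp
qed

lemma prefix_map_R_term: "prefix_map \<Lambda> c = Some t \<Longrightarrow> R_term R t"
  using R_triggers[of "last \<Lambda>"] nonempty last_eq
  by (auto simp: prefix_map_eq R_trigger_def split: const.splits if_splits)

lemma g_R_term: "R_term R t \<Longrightarrow> R_term R (g t)"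
  using prefix_map_R_term by (rule R_term_apply_map)

lemma R_trigger_shift:
  assumes "R_trigger R (\<psi>, \<mu>)"
  shows "R_trigger R (shift_trigger (prefix_map \<Lambda>) j (\<psi>, \<mu>))"
proof -
  have "R_term R ((g ^^ j) t)" if "R_term R t" for t
    using that by (induction j) (auto intro: g_R_term)
  then show ?thesis using assms by (auto simp: shift_trigger_eq R_trigger_def)
qed

text \<open>Reversibility requires the map to be defined on all constants of the skeleton, and
  \<open>prefix_map\<close> is defined only on constants \<open>CVar x\<close>.\<close>

lemma skel_reserved:
  assumes "\<tau> \<in> set (tl \<Lambda>)"
  shows "skel (shift_trigger (prefix_map \<Lambda>) j \<tau>) \<inter> reserved = {}"
proof -
  have "c \<in> dom (prefix_map \<Lambda>)" if "Base c \<in> skel (shift_trigger (prefix_map \<Lambda>) j \<tau>)" for c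
    using rev[OF assms] that by (simp add: reversible_def)
  then show ?thesis by (fastforce simp: reserved_def prefix_map_eq dom_def)
qed

text \<open>The step from \<open>j\<close> to \<open>Suc j\<close> uses reversibility for the
  skeleton of the trigger shifted \<open>j\<close> times, which is why prefixes require it for every
  \<open>j\<close>.\<close>

lemma uc_shift:
  assumes "\<tau> \<in> set (tl \<Lambda>)"
  shows "uc_unblockable R hc (shift_trigger (prefix_map \<Lambda>) j \<tau>)"
proof (induction j)
  case 0
  then show ?case using uc[OF assms] by (cases \<tau>) (simp add: shift_trigger_eq)
next
  case (Suc j)
  obtain \<psi> \<mu> where \<tau>: "\<tau> = (\<psi>, \<mu>)" by (cases \<tau>)
  have R: "R_trigger R (shift_trigger (prefix_map \<Lambda>) j \<tau>)" for j
    using R_trigger_shift R_triggers assms nonempty \<tau> by (metis list.set_sel(2))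
  obtain \<mu>' where \<mu>': "shift_trigger (prefix_map \<Lambda>) j \<tau> = (\<psi>, \<mu>')"
    by (simp add: \<tau> shift_trigger_eq)
  have S: "shift_trigger (prefix_map \<Lambda>) (Suc j) \<tau> = (\<psi>, g \<circ> \<mu>')"
    using \<mu>' by (simp add: \<tau> shift_trigger_Suc)
  show ?case
    unfolding S
    using R[of j] R[of "Suc j"] prefix_map_R_term hc skel_reserved[OF assms, of j]
      skel_reserved[OF assms, of "Suc j"] rev[OF assms, of j] Suc
    unfolding S \<mu>' by (rule uc_unblockable_shift)
qed

lemma s_Suc: "s (Suc m) = shift_trigger (prefix_map \<Lambda>) (m div n) (tl \<Lambda> ! (m mod n))"
  by (simp add: prefix_unfold_def n_def)

lemma s_R_trigger: "R_trigger R (s k)"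
proof (cases k)
  case 0
  then show ?thesis using \<rho> by (simp add: s_0 R_trigger_def \<sigma>_uc_def)
next
  case (Suc m)
  have "tl \<Lambda> ! (m mod n) \<in> set (tl \<Lambda>)"
    using n_pos by (simp add: n_def)
  then have "tl \<Lambda> ! (m mod n) \<in> set \<Lambda>" by (rule list.set_sel(2)[OF nonempty])
  then show ?thesis
    using R_trigger_shift R_triggers Suc by (metis s_Suc surj_pair)
qed

lemma s_g_unblockable: "g_unblockable (R, D) hc (s k)"
proof (cases k)
  case 0
  then show ?thesis using prefix hd_eq by (simp add: cyclicity_prefix_def s_0)
next
  case (Suc m)
  have m: "tl \<Lambda> ! (m mod n) \<in> set (tl \<Lambda>)" using n_pos by (simp add: n_def)
  obtain \<psi> \<mu> where s: "s k = (\<psi>, \<mu>)" by fastforce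
  then have shift: "shift_trigger (prefix_map \<Lambda>) (m div n) (tl \<Lambda> ! (m mod n)) = (\<psi>, \<mu>)"
    using Suc by (simp add: s_Suc)
  show ?thesis
    using s_R_trigger[of k] skel_reserved[OF m] uc_shift[OF m] unfolding s
    by (intro uc_unblockable_imp_g_unblockable[OF \<rho> hc]) (simp_all flip: shift)
qed

lemma s_prefix: "k < length \<Lambda> \<Longrightarrow> s k = \<Lambda> ! k"
proof (cases k)
  case 0
  then show ?thesis using nonempty by (simp add: prefix_unfold_def hd_conv_nth)
next
  case (Suc m)
  moreover assume "k < length \<Lambda>"
  ultimately have m: "m < n" by (simp add: length_eq)
  then have "tl \<Lambda> ! m = \<Lambda> ! k" using Suc by (simp add: nth_tl n_def)
  then show ?thesis using Suc m by (cases "\<Lambda> ! k") (simp add: s_Suc shift_trigger_eq)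
qed

lemma F_prefix: "k \<le> length \<Lambda> \<Longrightarrow> F k = facts_after D hc (nth \<Lambda>) k"
  by (induction k) (auto simp: s_prefix)

lemma loaded_prefix: "k < length \<Lambda> \<Longrightarrow> body_inst (s k) \<subseteq> F k"
  using loaded[of k] by (simp add: loaded_def s_prefix F_prefix)

lemma s_n: "s n = (\<rho>, \<sigma>\<^sub>n)"
proof -
  have "s n = \<Lambda> ! (length \<Lambda> - 1)" by (simp add: s_prefix length_eq)
  then have "s n = last \<Lambda>" using last_conv_nth[OF nonempty] by simp
  then show ?thesis using last_eq by (rule trans)
qed

text \<open>Index 0 is excluded: \<open>s n\<close> is the shift of \<open>s 0\<close> only up to
  the values outside the body variables of \<open>\<rho>\<close>.\<close>

lemma s_shift:
  assumes "k > 0"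
  obtains \<psi> \<mu> where "s k = (\<psi>, \<mu>)" "s (k + n) = (\<psi>, g \<circ> \<mu>)"
proof -
  obtain m where k: "k = Suc m" using assms by (cases k) auto
  obtain \<psi> \<mu> where m: "tl \<Lambda> ! (m mod n) = (\<psi>, \<mu>)" by fastforce
  have "s k = (\<psi>, (g ^^ (m div n)) \<circ> \<mu>)" by (simp add: k s_Suc m shift_trigger_eq)
  moreover have "s (k + n) = (\<psi>, g \<circ> ((g ^^ (m div n)) \<circ> \<mu>))"
    using n_pos by (simp add: k s_Suc m shift_trigger_eq comp_assoc div_add_self2)
  ultimately show thesis using that by blast
qed

lemma F_shift: "map_atom g ` F k \<subseteq> F (k + n)"
proof (induction k)
  case 0
  \<comment> \<open>The database is the body instance of the first trigger, so its image is that of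
    \<open>s n\<close>, which is loaded as part of the prefix.\<close>
  have "map_atom g ` D = body_inst (\<rho>, \<sigma>\<^sub>n)"
    unfolding rule_database_def body_inst_comp[symmetric]
    by (rule body_inst_cong) (simp add: g_uc)
  then show ?case using loaded_prefix[of n] by (simp add: s_n length_eq)
next
  case (Suc k)
  have "map_atom g ` out_hc hc (s k) = out_hc hc (s (k + n))"
  proof (cases "k = 0")
    case True
    have "hc \<rho> < branching \<rho>" using hc \<rho> by (simp add: is_head_choice_def)
    then have "out (hc \<rho>) (\<rho>, g \<circ> \<sigma>_uc) = out (hc \<rho>) (\<rho>, \<sigma>\<^sub>n)"
      by (rule out_cong) (simp add: g_uc frontier_uvars)
    then show ?thesis using True by (simp add: s_0 s_n out_hc_def map_out_apply_map)
  next
    case False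
    then obtain \<psi> \<mu> where "s k = (\<psi>, \<mu>)" "s (k + n) = (\<psi>, g \<circ> \<mu>)" by (auto intro: s_shift)
    then show ?thesis by (simp add: out_hc_def map_out_apply_map)
  qed
  then show ?case using Suc by (simp add: image_Un le_supI1)
qed

lemma s_loaded: "body_inst (s k) \<subseteq> F k"
proof (induction k rule: less_induct)
  case (less k)
  show ?case
  proof (cases "k < length \<Lambda>")
    case True
    then show ?thesis by (rule loaded_prefix)
  next
    case False
    \<comment> \<open>Step \<open>k\<close> repeats step \<open>m\<close> one round later;
      \<open>m\<close> is positive because the prefix has length \<open>Suc n\<close>.\<close>
    define m where "m = k - n"
    have m: "k = m + n" "0 < m" "m < k" using False length_eq n_pos by (auto simp: m_def)
    obtain \<psi> \<mu> where s: "s m = (\<psi>, \<mu>)" "s k = (\<psi>, g \<circ> \<mu>)"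
      using s_shift[OF m(2)] m(1) by metis
    have "map_atom g ` body_inst (s m) \<subseteq> map_atom g ` F m"
      using less[OF m(3)] by blast
    moreover have "body_inst (s k) = map_atom g ` body_inst (s m)"
      by (simp add: s body_inst_comp)
    ultimately show ?thesis using F_shift[of m] m(1) by auto
  qed
qed

text \<open>Functional terms originate from the first trigger: every later non-datalog trigger of the prefix
  already has a functional term in its frontier.\<close>

lemma functional_subterm:
  "k \<le> length \<Lambda> \<Longrightarrow> Func f ts \<in> terms (F k) \<Longrightarrow>
     \<exists>f'. Func f' (map \<sigma>_uc (frontier \<rho>)) \<in> subterms (Func f ts)"
proof (induction k arbitrary: f ts)
  case 0
  then show ?case
    by (auto simp: rule_database_def terms_body_inst \<sigma>_uc_def)
next
  case (Suc k)
  have k: "k \<le> length \<Lambda>" using Suc.prems by simp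
  obtain \<psi> \<mu> where s: "s k = (\<psi>, \<mu>)" by fastforce
  have IH: "\<exists>f'. Func f' (map \<sigma>_uc (frontier \<rho>)) \<in> subterms (Func e us)"
    if "Func e us \<in> subterms (\<mu> x)" "x \<in> uvars \<psi>" for e us x
  proof -
    have "Func e us \<in> terms (body_inst (s k))" using that by (auto simp: s terms_body_inst)
    then have "Func e us \<in> terms (F k)" using terms_mono[OF s_loaded] by blast
    then show ?thesis using Suc.IH k by blast
  qed
  show ?case
  proof (cases "Func f ts \<in> terms (F k)")
    case True
    then show ?thesis using Suc.IH k by blast
  next
    case False
    then have "Func f ts \<in> terms (out (hc \<psi>) (\<psi>, \<mu>))"
      using Suc.prems(2) by (simp add: terms_Un s out_hc_def)
    then show ?thesis
    proof (cases rule: terms_out_cases)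
      case (1 x)
      then show ?thesis using IH by blast
    next
      case (2 x)
      show ?thesis
      proof (cases "k = 0")
        case True
        then have "Func f ts = Func (Sk \<rho> (hc \<rho>) x) (map \<sigma>_uc (frontier \<rho>))"
          using 2(3) s s_0 by simp
        then show ?thesis by (metis subterms_refl)
      next
        case k0: False
        have tl: "(\<psi>, \<mu>) \<in> set (tl \<Lambda>)"
        proof -
          have k': "k - 1 < length (tl \<Lambda>)" "k < length \<Lambda>" using k0 Suc.prems(1) by simp_all
          then have "tl \<Lambda> ! (k - 1) = (\<psi>, \<mu>)" using s k0 by (simp add: nth_tl s_prefix)
          then show ?thesis using nth_mem[OF k'(1)] by simp
        qed
        then have R: "R_trigger R (\<psi>, \<mu>)"
          using R_triggers nonempty by (metis list.set_sel(2))
        have "x \<in> exvars \<psi> (hc \<psi>)" using 2(1,2) by (simp add: exvars_iff)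
        moreover have "hc \<psi> < branching \<psi>"
          using hc R by (simp add: is_head_choice_def R_trigger_def)
        ultimately have "\<not> datalog \<psi>" by (auto simp: datalog_def)
        then obtain z e us where z: "z \<in> set (frontier \<psi>)" "\<mu> z = Func e us"
          using uc_unblockable_functional[OF R hc uc[OF tl]] by metis
        then obtain f' where "Func f' (map \<sigma>_uc (frontier \<rho>)) \<in> subterms (\<mu> z)"
          using IH[of e us z] frontier_uvars by auto
        moreover have "\<mu> z \<in> subterms (Func f ts)" using 2(3) z(1) by force
        ultimately show ?thesis using subterms_trans by blast
      qed
    qed
  qed
qed

text \<open>For a frontier variable \<open>z\<close> with a functional value in the last trigger,
  the iterates of \<open>g\<close> on the constant of \<open>z\<close> grow strictly in size. They
  all occur in the sequence, but each \<open>F i\<close> has only finitely many terms.\<close>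

lemma s_growing: "growing_seq (R, D) hc s"
proof -
  have tl: "(\<rho>, \<sigma>\<^sub>n) \<in> set (tl \<Lambda>)" using last_in_tl last_eq by simp
  have R: "R_trigger R (\<rho>, \<sigma>\<^sub>n)" using s_R_trigger[of n] by (simp add: s_n)
  obtain z e us where z: "z \<in> set (frontier \<rho>)" "\<sigma>\<^sub>n z = Func e us"
    using uc_unblockable_functional[OF R hc uc[OF tl] cyclic_rule] .
  have zu: "z \<in> uvars \<rho>" using frontier_uvars[OF z(1)] .
  have body: "terms (body_inst (s k)) \<subseteq> terms (F k)" for k
    using s_loaded terms_mono by blast
  have "\<sigma>\<^sub>n z \<in> terms (F n)" using body[of n] zu by (force simp: s_n terms_body_inst)
  \<comment> \<open>The arguments of this Skolem term are the constants of the whole frontier, among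
    them the constant of \<open>z\<close> itself.\<close>
  then obtain f' where f': "Func f' (map \<sigma>_uc (frontier \<rho>)) \<in> subterms (\<sigma>\<^sub>n z)"
    using functional_subterm[of n e us] length_eq z(2) by auto
  define t where "t j = (g ^^ j) (\<sigma>_uc z)" for j
  have t_Suc: "t (Suc j) = (g ^^ j) (\<sigma>\<^sub>n z)" for j
    using g_uc[OF zu] by (simp add: t_def funpow_swap1)
  have "size (t j) < size (t (Suc j))" for j
  proof -
    let ?ts = "map (g ^^ j) (map \<sigma>_uc (frontier \<rho>))"
    have "Func f' ?ts \<in> subterms (t (Suc j))"
      using funpow_subterms[OF f'] by (simp only: t_Suc funpow_apply_map_Func)
    then have "size (Func f' ?ts) \<le> size (t (Suc j))" by (rule subterms_size)
    moreover have "t j \<in> set ?ts" using z(1) by (auto simp: t_def)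
    then have "size (t j) \<le> size_list size ?ts"
      using size_list_estimation'[of "t j" ?ts "size (t j)" size] by simp
    ultimately show ?thesis by simp
  qed
  then have "strict_mono (\<lambda>j. size (t (Suc j)))" by (simp add: strict_mono_Suc_iff)
  then have "inj (\<lambda>j. size (t (Suc j)))" by (rule strict_mono_imp_inj_on)
  then have "inj (\<lambda>j. t (Suc j))" by (auto simp: inj_def)
  then have inf: "infinite (range (\<lambda>j. t (Suc j)))" by (simp add: finite_image_iff)
  \<comment> \<open>Step \<open>n + j * n\<close> is the last one of round \<open>j\<close>, whose
    substitution is the \<open>j\<close>-fold shift of \<open>\<sigma>\<^sub>n\<close>.\<close>
  have occ: "t (Suc j) \<in> terms (F (n + j * n))" for j
  proof -
    obtain p where p: "n = Suc p" using n_pos by (cases n) auto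
    then have "p < n" by simp
    then have "(p + j * n) div n = j" "(p + j * n) mod n = p" by simp_all
    moreover have "n + j * n = Suc (p + j * n)" using p by simp
    ultimately have "s (n + j * n) = shift_trigger (prefix_map \<Lambda>) j (tl \<Lambda> ! p)"
      by (metis s_Suc)
    also have "tl \<Lambda> ! p = (\<rho>, \<sigma>\<^sub>n)"
      using s_prefix[of n] s_n \<open>p < n\<close> p by (simp add: length_eq nth_tl n_def[symmetric])
    finally have "s (n + j * n) = (\<rho>, (g ^^ j) \<circ> \<sigma>\<^sub>n)" by (simp add: shift_trigger_eq)
    then show ?thesis using body[of "n + j * n"] zu by (force simp: terms_body_inst t_Suc)
  qed
  show ?thesis
    unfolding growing_seq_def
  proof
    fix i
    have "finite (terms (F i))"
      using database_rule_database by (auto intro!: finite_terms finite_facts_after simp: database_def)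
    then have "\<not> range (\<lambda>j. t (Suc j)) \<subseteq> terms (F i)" using inf finite_subset by metis
    then obtain j where j: "t (Suc j) \<notin> terms (F i)" by blast
    \<comment> \<open>The maximum makes the later index exceed \<open>i\<close> even if the term
      occurs only by step \<open>n + j * n\<close>.\<close>
    let ?j = "max (Suc i) (n + j * n)"
    have "t (Suc j) \<in> terms (F ?j)"
      using occ[of j] terms_mono[OF facts_after_mono[of "n + j * n" ?j]] by auto
    then show "\<exists>j>i. \<exists>t. t \<in> terms (facts_after (snd (R, D)) hc s j) \<and>
        t \<notin> terms (facts_after (snd (R, D)) hc s i)"
      using j by (intro exI[of _ ?j]) auto
  qed
qed

lemma cyclicity_sequence_unfold: "cyclicity_sequence (R, D) hc s"
  using s_R_trigger s_g_unblockable s_loaded s_growing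
  by (simp add: cyclicity_sequence_def loaded_seq_def loaded_def)

end

theorem theorem3:
  fixes R :: "rule set" and hc :: head_choice and \<rho> :: rule and \<Lambda> :: "trigger list"
  assumes "rule_set R"
    and "is_head_choice R hc"
    and "\<rho> \<in> R"
    and "cyclicity_prefix R hc \<rho> \<Lambda>"
  shows "cyclicity_sequence (R, rule_database \<rho>) hc (prefix_unfold \<Lambda>) \<and> never_terminates R"
proof -
  interpret cyclicity_prefix_unfolding R hc \<rho> \<Lambda>
    using assms(2-4) by unfold_locales
  show ?thesis
    using cyclicity_sequence_unfold
      cyclicity_sequence_imp_never_terminates[OF database_rule_database] by blast
qed

end
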